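(* Let $\Gamma=(\mathbb{C},\mathbb{X},I,H,\eta,\epsilon,\mathcal{E},\mathcal{F})$ be an admissible Galois structure in which $\mathcal{E}$ and $\mathcal{F}$ are the classes of all regular epimorphisms of $\mathbb{C}$ and of $\mathbb{X}$ respectively. Suppose that the following condition holds: given a regular epimorphism $h\colon B'\to B$ in $\mathbb{C}$ with kernel pair $\mathrm{Eq}(h)\rightrightarrows B'$ (viewed as a reflexive graph via the diagonal), a reflexive graph $R\rightrightarrows A'$ in $\mathbb{C}$, fibrations $f''\colon R\to\mathrm{Eq}(h)$ and $f'\colon A'\to B'$ forming a morphism of reflexive graphs (so that one has a reflexive graph $f''\rightrightarrows f'$ in $\mathrm{Fib}(\mathbb{C})$), and its coequaliser $(g,h)\colon f'\to f$ in $\mathrm{Arr}(\mathbb{C})$, where $g\colon A'\to A$ is the coequaliser of $R\rightrightarrows A'$ and $f\colon A\to B$ is the induced morphism: if $f'$ and $f''$ are normal extensions, then $f$ is also a normal extension. Then, for any object $B$ of $\mathbb{C}$, $\mathrm{Norm}(B)$ is a reflective subcategory of $(\mathcal{E}\downarrow B)$. As a consequence, normal extensions are reflective amongst fibrations, i.e. $\mathrm{Norm}(\mathbb{C})$ is a reflective subcategory of $\mathrm{Fib}(\mathbb{C})$.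
   Context: A Galois structure $\Gamma=(\mathbb{C},\mathbb{X},I,H,\eta,\epsilon,\mathcal{E},\mathcal{F})$ consists of an adjunction $I\dashv H$, $I\colon\mathbb{C}\to\mathbb{X}$, $H\colon\mathbb{X}\to\mathbb{C}$, with unit $\eta\colon 1_{\mathbb{C}}\Rightarrow HI$ and counit $\epsilon\colon IH\Rightarrow 1_{\mathbb{X}}$, between Barr-exact categories $\mathbb{C}$ and $\mathbb{X}$, and classes of morphisms $\mathcal{E}$ in $\mathbb{C}$ and $\mathcal{F}$ in $\mathbb{X}$ (called fibrations) such that: $\mathcal{E}$ and $\mathcal{F}$ contain all isomorphisms, are pullback-stable and are closed under composition; $H(\mathcal{F})\subseteq\mathcal{E}$ and $I(\mathcal{E})\subseteq\mathcal{F}$; $\mathcal{E}$ and $\mathcal{F}$ consist of the regular epimorphisms in $\mathbb{C}$ and $\mathbb{X}$, respectively. It is moreover assumed that $\mathbb{C}$ has coequalisers of reflexive graphs (a reflexive graph is a pair of parallel morphisms with a common section). For an object $B$, $(\mathcal{E}\downarrow B)$ is the full subcategory of the slice category $(\mathbb{C}\downarrow B)$ determined by the morphisms in $\mathcal{E}$; similarly for $(\mathcal{F}\downarrow I(B))$. The functor $H^B\colon(\mathcal{F}\downarrow I(B))\to(\mathcal{E}\downarrow B)$ sends a fibration $g\colon X\to I(B)$ to the pullback of $H(g)\colon H(X)\to HI(B)$ along $\eta_B\colon B\to HI(B)$. $\Gamma$ is admissible when $H^B$ is full and faithful for every object $B$ of $\mathbb{C}$. A trivial extension is a fibration $f\colon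 A\to B$ in $\mathbb{C}$ such that the naturality square $HI(f)\circ\eta_A=\eta_B\circ f$ is a pullback. A normal extension is a fibration in $\mathbb{C}$ whose kernel pair projections are trivial extensions. $\mathrm{Arr}(\mathbb{C})$ is the category of arrows of $\mathbb{C}$; $\mathrm{Fib}(\mathbb{C})$ is its full subcategory determined by the fibrations (morphisms in $\mathcal{E}$); $\mathrm{Norm}(\mathbb{C})$ is the full subcategory of $\mathrm{Fib}(\mathbb{C})$ determined by the normal extensions; $\mathrm{Norm}(B)$ is the full subcategory of $(\mathcal{E}\downarrow B)$ determined by the normal extensions over $B$. *)

theory Defs
  imports Main
begin

section \<open>Categories, functors, adjunctions\<close>

record ('o, 'm) cat =
  Obj :: "'o set"
  Mor :: "'m set"
  Dom :: "'m \<Rightarrow> 'o"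
  Cod :: "'m \<Rightarrow> 'o"
  Ident :: "'o \<Rightarrow> 'm"
  Comp :: "'m \<Rightarrow> 'm \<Rightarrow> 'm"  (infixr "\<cdot>\<index>" 70)

locale category =
  fixes C :: "('o, 'm) cat" (structure)
  assumes Dom_in: "f \<in> Mor C \<Longrightarrow> Dom C f \<in> Obj C"
    and Cod_in: "f \<in> Mor C \<Longrightarrow> Cod C f \<in> Obj C"
    and Ident_in: "a \<in> Obj C \<Longrightarrow> Ident C a \<in> Mor C"
    and Dom_Ident: "a \<in> Obj C \<Longrightarrow> Dom C (Ident C a) = a"
    and Cod_Ident: "a \<in> Obj C \<Longrightarrow> Cod C (Ident C a) = a"
    and Comp_in: "\<lbrakk>f \<in> Mor C; g \<in> Mor C; Cod C f = Dom C g\<rbrakk> \<Longrightarrow> g \<cdot> f \<in> Mor C"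
    and Dom_Comp: "\<lbrakk>f \<in> Mor C; g \<in> Mor C; Cod C f = Dom C g\<rbrakk> \<Longrightarrow> Dom C (g \<cdot> f) = Dom C f"
    and Cod_Comp: "\<lbrakk>f \<in> Mor C; g \<in> Mor C; Cod C f = Dom C g\<rbrakk> \<Longrightarrow> Cod C (g \<cdot> f) = Cod C g"
    and Comp_Ident_right: "f \<in> Mor C \<Longrightarrow> f \<cdot> Ident C (Dom C f) = f"
    and Comp_Ident_left: "f \<in> Mor C \<Longrightarrow> Ident C (Cod C f) \<cdot> f = f"
    and Comp_assoc: "\<lbrakk>f \<in> Mor C; g \<in> Mor C; h \<in> Mor C; Cod C f = Dom C g; Cod C g = Dom C h\<rbrakk>
      \<Longrightarrow> (h \<cdot> g) \<cdot> f = h \<cdot> (g \<cdot> f)"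

definition hom :: "('o, 'm) cat \<Rightarrow> 'o \<Rightarrow> 'o \<Rightarrow> 'm set" where
  "hom C a b = {f \<in> Mor C. Dom C f = a \<and> Cod C f = b}"

record ('o, 'm, 'p, 'n) functr =
  FObj :: "'o \<Rightarrow> 'p"
  FMor :: "'m \<Rightarrow> 'n"

locale is_functor = A: category A + B: category B
  for A :: "('o, 'm) cat" and B :: "('p, 'n) cat" +
  fixes F :: "('o, 'm, 'p, 'n) functr"
  assumes FObj_in: "a \<in> Obj A \<Longrightarrow> FObj F a \<in> Obj B"
    and FMor_in: "f \<in> Mor A \<Longrightarrow> FMor F f \<in> Mor B"
    and FMor_Dom: "f \<in> Mor A \<Longrightarrow> Dom B (FMor F f) = FObj F (Dom A f)"
    and FMor_Cod: "f \<in> Mor A \<Longrightarrow> Cod B (FMor F f) = FObj F (Cod A f)"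
    and FMor_Ident: "a \<in> Obj A \<Longrightarrow> FMor F (Ident A a) = Ident B (FObj F a)"
    and FMor_Comp: "\<lbrakk>f \<in> Mor A; g \<in> Mor A; Cod A f = Dom A g\<rbrakk>
      \<Longrightarrow> FMor F (g \<cdot>\<^bsub>A\<^esub> f) = FMor F g \<cdot>\<^bsub>B\<^esub> FMor F f"

definition inclusion :: "('o, 'm, 'o, 'm) functr" where
  "inclusion = \<lparr>FObj = (\<lambda>a. a), FMor = (\<lambda>f. f)\<rparr>"

definition comp_functor ::
    "('p, 'n, 'q, 'k) functr \<Rightarrow> ('o, 'm, 'p, 'n) functr \<Rightarrow> ('o, 'm, 'q, 'k) functr" where
  "comp_functor G F = \<lparr>FObj = (\<lambda>a. FObj G (FObj F a)), FMor = (\<lambda>f. FMor G (FMor F f))\<rparr>"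

definition full :: "('o, 'm) cat \<Rightarrow> ('p, 'n) cat \<Rightarrow> ('o, 'm, 'p, 'n) functr \<Rightarrow> bool" where
  "full A B F \<longleftrightarrow> (\<forall>a\<in>Obj A. \<forall>b\<in>Obj A. \<forall>g\<in>hom B (FObj F a) (FObj F b).
     \<exists>f\<in>hom A a b. FMor F f = g)"

definition faithful :: "('o, 'm) cat \<Rightarrow> ('p, 'n) cat \<Rightarrow> ('o, 'm, 'p, 'n) functr \<Rightarrow> bool" where
  "faithful A B F \<longleftrightarrow> (\<forall>a\<in>Obj A. \<forall>b\<in>Obj A. inj_on (FMor F) (hom A a b))"

locale nat_trans = F: is_functor A B F + G: is_functor A B G
  for A :: "('o, 'm) cat" and B :: "('p, 'n) cat" and F G +
  fixes t :: "'o \<Rightarrow> 'n"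
  assumes component: "a \<in> Obj A \<Longrightarrow> t a \<in> hom B (FObj F a) (FObj G a)"
    and naturality: "f \<in> Mor A \<Longrightarrow>
      t (Cod A f) \<cdot>\<^bsub>B\<^esub> FMor F f = FMor G f \<cdot>\<^bsub>B\<^esub> t (Dom A f)"

text \<open>\<open>adjunction C X I H \<eta> \<epsilon>\<close>: \<open>I\<close> is left adjoint to \<open>H\<close>. Here and in slices and
  subcategories, \<^const>\<open>inclusion\<close> also serves as the identity functor.\<close>

locale adjunction =
  unit: nat_trans C C "inclusion" "comp_functor H I" \<eta> +
  counit: nat_trans X X "comp_functor I H" "inclusion" \<epsilon> +
  I: is_functor C X I + H: is_functor X C H
  for C :: "('o, 'm) cat" and X :: "('p, 'n) cat" and I H \<eta> \<epsilon> +
  assumes triangle_I: "a \<in> Obj C \<Longrightarrow>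
      \<epsilon> (FObj I a) \<cdot>\<^bsub>X\<^esub> FMor I (\<eta> a) = Ident X (FObj I a)"
    and triangle_H: "x \<in> Obj X \<Longrightarrow>
      FMor H (\<epsilon> x) \<cdot>\<^bsub>C\<^esub> \<eta> (FObj H x) = Ident C (FObj H x)"

definition full_subcat :: "('o, 'm) cat \<Rightarrow> 'o set \<Rightarrow> ('o, 'm) cat" where
  "full_subcat C S = C\<lparr>Obj := Obj C \<inter> S, Mor := {f \<in> Mor C. Dom C f \<in> S \<and> Cod C f \<in> S}\<rparr>"

text \<open>The adjunction includes that \<^const>\<open>inclusion\<close> is a functor from \<open>D\<close> to \<open>C\<close>, that is,
  that \<open>D\<close> is a subcategory of \<open>C\<close>.\<close>

definition reflective_subcategory :: "('o, 'm) cat \<Rightarrow> ('o, 'm) cat \<Rightarrow> bool" where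
  "reflective_subcategory D C \<longleftrightarrow> (\<exists>L \<eta> \<epsilon>. adjunction C D L inclusion \<eta> \<epsilon>)"


section \<open>Limits, coequalisers, Barr-exactness\<close>

definition is_cone ::
    "('i, 'j) cat \<Rightarrow> ('o, 'm) cat \<Rightarrow> ('i, 'j, 'o, 'm) functr \<Rightarrow> 'o \<Rightarrow> ('i \<Rightarrow> 'm) \<Rightarrow> bool" where
  "is_cone J C D a t \<longleftrightarrow> a \<in> Obj C \<and> (\<forall>i\<in>Obj J. t i \<in> hom C a (FObj D i)) \<and>
     (\<forall>j\<in>Mor J. FMor D j \<cdot>\<^bsub>C\<^esub> t (Dom J j) = t (Cod J j))"

definition is_limit ::
    "('i, 'j) cat \<Rightarrow> ('o, 'm) cat \<Rightarrow> ('i, 'j, 'o, 'm) functr \<Rightarrow> 'o \<Rightarrow> ('i \<Rightarrow> 'm) \<Rightarrow> bool" where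
  "is_limit J C D a t \<longleftrightarrow> is_cone J C D a t \<and>
     (\<forall>b s. is_cone J C D b s \<longrightarrow> (\<exists>!u. u \<in> hom C b a \<and> (\<forall>i\<in>Obj J. t i \<cdot>\<^bsub>C\<^esub> u = s i)))"

text \<open>Every finite category is isomorphic to one whose objects and morphisms are natural
  numbers, so that these suffice as shapes of finite diagrams.\<close>

definition finitely_complete :: "('o, 'm) cat \<Rightarrow> bool" where
  "finitely_complete C \<longleftrightarrow> (\<forall>(J :: (nat, nat) cat) D.
     finite (Obj J) \<and> finite (Mor J) \<and> is_functor J C D \<longrightarrow> (\<exists>a t. is_limit J C D a t))"

text \<open>\<open>is_pullback C f g p q\<close>: the square \<open>f \<cdot> p = g \<cdot> q\<close> is a pullback, so \<open>q\<close> is the pullback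
  of \<open>f\<close> along \<open>g\<close> and \<open>p\<close> is the pullback of \<open>g\<close> along \<open>f\<close>.\<close>

definition is_pullback :: "('o, 'm) cat \<Rightarrow> 'm \<Rightarrow> 'm \<Rightarrow> 'm \<Rightarrow> 'm \<Rightarrow> bool" where
  "is_pullback C f g p q \<longleftrightarrow>
     f \<in> Mor C \<and> g \<in> Mor C \<and> p \<in> Mor C \<and> q \<in> Mor C \<and>
     Cod C f = Cod C g \<and> Dom C p = Dom C q \<and> Cod C p = Dom C f \<and> Cod C q = Dom C g \<and>
     f \<cdot>\<^bsub>C\<^esub> p = g \<cdot>\<^bsub>C\<^esub> q \<and>
     (\<forall>a\<in>Mor C. \<forall>b\<in>Mor C.
        Dom C a = Dom C b \<and> Cod C a = Dom C f \<and> Cod C b = Dom C g \<and> f \<cdot>\<^bsub>C\<^esub> a = g \<cdot>\<^bsub>C\<^esub> b \<longrightarrow>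
        (\<exists>!u. u \<in> hom C (Dom C a) (Dom C p) \<and> p \<cdot>\<^bsub>C\<^esub> u = a \<and> q \<cdot>\<^bsub>C\<^esub> u = b))"

definition is_kernel_pair :: "('o, 'm) cat \<Rightarrow> 'm \<Rightarrow> 'm \<Rightarrow> 'm \<Rightarrow> bool" where
  "is_kernel_pair C f p q \<longleftrightarrow> is_pullback C f f p q"

definition parallel :: "('o, 'm) cat \<Rightarrow> 'm \<Rightarrow> 'm \<Rightarrow> bool" where
  "parallel C d c \<longleftrightarrow> d \<in> Mor C \<and> c \<in> Mor C \<and> Dom C d = Dom C c \<and> Cod C d = Cod C c"

definition is_coequaliser :: "('o, 'm) cat \<Rightarrow> 'm \<Rightarrow> 'm \<Rightarrow> 'm \<Rightarrow> bool" where
  "is_coequaliser C d c q \<longleftrightarrow>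
     parallel C d c \<and> q \<in> Mor C \<and> Dom C q = Cod C d \<and> q \<cdot>\<^bsub>C\<^esub> d = q \<cdot>\<^bsub>C\<^esub> c \<and>
     (\<forall>k\<in>Mor C. Dom C k = Cod C d \<and> k \<cdot>\<^bsub>C\<^esub> d = k \<cdot>\<^bsub>C\<^esub> c \<longrightarrow>
        (\<exists>!u. u \<in> hom C (Cod C q) (Cod C k) \<and> u \<cdot>\<^bsub>C\<^esub> q = k))"

definition regular_epi :: "('o, 'm) cat \<Rightarrow> 'm \<Rightarrow> bool" where
  "regular_epi C e \<longleftrightarrow> (\<exists>d c. is_coequaliser C d c e)"

definition is_iso :: "('o, 'm) cat \<Rightarrow> 'm \<Rightarrow> bool" where
  "is_iso C f \<longleftrightarrow> f \<in> Mor C \<and> (\<exists>g\<in>hom C (Cod C f) (Dom C f).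
     g \<cdot>\<^bsub>C\<^esub> f = Ident C (Dom C f) \<and> f \<cdot>\<^bsub>C\<^esub> g = Ident C (Cod C f))"

definition pullback_stable :: "('o, 'm) cat \<Rightarrow> 'm set \<Rightarrow> bool" where
  "pullback_stable C S \<longleftrightarrow> (\<forall>f g p q. f \<in> S \<and> is_pullback C f g p q \<longrightarrow> q \<in> S)"

text \<open>\<open>s\<close> is the common section.\<close>

definition reflexive_graph :: "('o, 'm) cat \<Rightarrow> 'm \<Rightarrow> 'm \<Rightarrow> 'm \<Rightarrow> bool" where
  "reflexive_graph C d c s \<longleftrightarrow> parallel C d c \<and> s \<in> hom C (Cod C d) (Dom C d) \<and>
     d \<cdot>\<^bsub>C\<^esub> s = Ident C (Cod C d) \<and> c \<cdot>\<^bsub>C\<^esub> s = Ident C (Cod C d)"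

definition has_reflexive_coequalisers :: "('o, 'm) cat \<Rightarrow> bool" where
  "has_reflexive_coequalisers C \<longleftrightarrow>
     (\<forall>d c s. reflexive_graph C d c s \<longrightarrow> (\<exists>q. is_coequaliser C d c q))"

definition jointly_monic :: "('o, 'm) cat \<Rightarrow> 'm \<Rightarrow> 'm \<Rightarrow> bool" where
  "jointly_monic C d c \<longleftrightarrow> (\<forall>u\<in>Mor C. \<forall>v\<in>Mor C.
     Dom C u = Dom C v \<and> Cod C u = Dom C d \<and> Cod C v = Dom C d \<and>
     d \<cdot>\<^bsub>C\<^esub> u = d \<cdot>\<^bsub>C\<^esub> v \<and> c \<cdot>\<^bsub>C\<^esub> u = c \<cdot>\<^bsub>C\<^esub> v \<longrightarrow> u = v)"

text \<open>Internal equivalence relations. In the last conjunct, the domain of \<open>p\<close> is the object of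
  composable pairs: intuitively, \<open>p\<close> and \<open>q\<close> send \<open>((x, y), (y, z))\<close> to \<open>(x, y)\<close> and \<open>(y, z)\<close>.\<close>

definition equivalence_relation :: "('o, 'm) cat \<Rightarrow> 'm \<Rightarrow> 'm \<Rightarrow> bool" where
  "equivalence_relation C d c \<longleftrightarrow> parallel C d c \<and> jointly_monic C d c \<and>
     (\<exists>s. reflexive_graph C d c s) \<and>
     (\<exists>t\<in>hom C (Dom C d) (Dom C d). d \<cdot>\<^bsub>C\<^esub> t = c \<and> c \<cdot>\<^bsub>C\<^esub> t = d) \<and>
     (\<forall>p q. is_pullback C c d p q \<longrightarrow>
        (\<exists>m\<in>hom C (Dom C p) (Dom C d). d \<cdot>\<^bsub>C\<^esub> m = d \<cdot>\<^bsub>C\<^esub> p \<and> c \<cdot>\<^bsub>C\<^esub> m = c \<cdot>\<^bsub>C\<^esub> q))"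

locale regular_category = category C
  for C :: "('o, 'm) cat" (structure) +
  assumes finite_limits: "finitely_complete C"
    and kernel_pair_coequalisers: "is_kernel_pair C f p q \<Longrightarrow> \<exists>e. is_coequaliser C p q e"
    and regular_epi_pullback_stable: "pullback_stable C {e. regular_epi C e}"

locale barr_exact_category = regular_category C
  for C :: "('o, 'm) cat" (structure) +
  assumes effective: "equivalence_relation C d c \<Longrightarrow> \<exists>f. is_kernel_pair C f d c"


section \<open>Slice and arrow categories\<close>

text \<open>A morphism \<open>a\<close> from \<open>f\<close> to \<open>g\<close> in the slice over \<open>b\<close> is encoded as the triple \<open>(f, a, g)\<close>.\<close>

definition slice :: "('o, 'm) cat \<Rightarrow> 'o \<Rightarrow> ('m, 'm \<times> 'm \<times> 'm) cat" where
  "slice C b = \<lparr>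
     Obj = {f \<in> Mor C. Cod C f = b},
     Mor = {(f, a, g). f \<in> Mor C \<and> g \<in> Mor C \<and> Cod C f = b \<and> Cod C g = b \<and>
              a \<in> hom C (Dom C f) (Dom C g) \<and> g \<cdot>\<^bsub>C\<^esub> a = f},
     Dom = (\<lambda>(f, a, g). f),
     Cod = (\<lambda>(f, a, g). g),
     Ident = (\<lambda>f. (f, Ident C (Dom C f), f)),
     Comp = (\<lambda>(f', a', g') (f, a, g). (f, a' \<cdot>\<^bsub>C\<^esub> a, g'))\<rparr>"

text \<open>A commutative square \<open>g \<cdot> a = b \<cdot> f\<close>, viewed as a morphism from \<open>f\<close> to \<open>g\<close>, is encoded as
  \<open>(f, (a, b), g)\<close>.\<close>

definition arrow_cat :: "('o, 'm) cat \<Rightarrow> ('m, 'm \<times> ('m \<times> 'm) \<times> 'm) cat" where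
  "arrow_cat C = \<lparr>
     Obj = Mor C,
     Mor = {(f, (a, b), g). f \<in> Mor C \<and> g \<in> Mor C \<and>
              a \<in> hom C (Dom C f) (Dom C g) \<and> b \<in> hom C (Cod C f) (Cod C g) \<and>
              g \<cdot>\<^bsub>C\<^esub> a = b \<cdot>\<^bsub>C\<^esub> f},
     Dom = (\<lambda>(f, ab, g). f),
     Cod = (\<lambda>(f, ab, g). g),
     Ident = (\<lambda>f. (f, (Ident C (Dom C f), Ident C (Cod C f)), f)),
     Comp = (\<lambda>(f', (a', b'), g') (f, (a, b), g). (f, (a' \<cdot>\<^bsub>C\<^esub> a, b' \<cdot>\<^bsub>C\<^esub> b), g'))\<rparr>"


section \<open>Galois structures\<close>

locale galois_structure =
  C: barr_exact_category C + X: barr_exact_category X + adjunction C X I H \<eta> \<epsilon>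
  for C :: "('o, 'm) cat" and X :: "('p, 'n) cat" and I H \<eta> \<epsilon> +
  fixes \<E> :: "'m set" and \<F> :: "'n set"
  assumes E_Mor: "\<E> \<subseteq> Mor C" and F_Mor: "\<F> \<subseteq> Mor X"
    and E_iso: "is_iso C f \<Longrightarrow> f \<in> \<E>" and F_iso: "is_iso X x \<Longrightarrow> x \<in> \<F>"
    and E_pullback: "pullback_stable C \<E>" and F_pullback: "pullback_stable X \<F>"
    and E_Comp: "\<lbrakk>f \<in> \<E>; g \<in> \<E>; Cod C f = Dom C g\<rbrakk> \<Longrightarrow> g \<cdot>\<^bsub>C\<^esub> f \<in> \<E>"
    and F_Comp: "\<lbrakk>x \<in> \<F>; y \<in> \<F>; Cod X x = Dom X y\<rbrakk> \<Longrightarrow> y \<cdot>\<^bsub>X\<^esub> x \<in> \<F>"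
    and H_fib: "FMor H ` \<F> \<subseteq> \<E>" and I_fib: "FMor I ` \<E> \<subseteq> \<F>"

text \<open>\<open>fib_over C \<E> b\<close> is the category of fibrations over \<open>b\<close>, and \<open>Fib C \<E>\<close> that of all
  fibrations.\<close>

definition fib_over :: "('o, 'm) cat \<Rightarrow> 'm set \<Rightarrow> 'o \<Rightarrow> ('m, 'm \<times> 'm \<times> 'm) cat" where
  "fib_over C \<E> b = full_subcat (slice C b) \<E>"

definition Fib :: "('o, 'm) cat \<Rightarrow> 'm set \<Rightarrow> ('m, 'm \<times> ('m \<times> 'm) \<times> 'm) cat" where
  "Fib C \<E> = full_subcat (arrow_cat C) \<E>"

text \<open>A chosen pullback; different choices give naturally isomorphic functors \<open>H\<^sup>B\<close> below.\<close>

definition chosen_pullback :: "('o, 'm) cat \<Rightarrow> 'm \<Rightarrow> 'm \<Rightarrow> 'm \<times> 'm" where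
  "chosen_pullback C f g = (SOME pq. is_pullback C f g (fst pq) (snd pq))"

definition H_over :: "('o, 'm) cat \<Rightarrow> ('p, 'n, 'o, 'm) functr \<Rightarrow> ('o \<Rightarrow> 'm) \<Rightarrow> 'o
    \<Rightarrow> ('n, 'n \<times> 'n \<times> 'n, 'm, 'm \<times> 'm \<times> 'm) functr" where
  "H_over C H \<eta> b =
     (let P = (\<lambda>g. fst (chosen_pullback C (\<eta> b) (FMor H g)));
          Q = (\<lambda>g. snd (chosen_pullback C (\<eta> b) (FMor H g)))
      in \<lparr>FObj = P,
          FMor = (\<lambda>(g, u, g'). (P g,
            (THE v. v \<in> hom C (Dom C (P g)) (Dom C (P g')) \<and>
               P g' \<cdot>\<^bsub>C\<^esub> v = P g \<and> Q g' \<cdot>\<^bsub>C\<^esub> v = FMor H u \<cdot>\<^bsub>C\<^esub> Q g),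
            P g'))\<rparr>)"

definition admissible :: "('o, 'm) cat \<Rightarrow> ('p, 'n) cat \<Rightarrow> ('o, 'm, 'p, 'n) functr
    \<Rightarrow> ('p, 'n, 'o, 'm) functr \<Rightarrow> ('o \<Rightarrow> 'm) \<Rightarrow> 'm set \<Rightarrow> 'n set \<Rightarrow> bool" where
  "admissible C X I H \<eta> \<E> \<F> \<longleftrightarrow> (\<forall>b\<in>Obj C.
     full (fib_over X \<F> (FObj I b)) (fib_over C \<E> b) (H_over C H \<eta> b) \<and>
     faithful (fib_over X \<F> (FObj I b)) (fib_over C \<E> b) (H_over C H \<eta> b))"

definition trivial_extension :: "('o, 'm) cat \<Rightarrow> ('o, 'm, 'p, 'n) functr
    \<Rightarrow> ('p, 'n, 'o, 'm) functr \<Rightarrow> ('o \<Rightarrow> 'm) \<Rightarrow> 'm set \<Rightarrow> 'm \<Rightarrow> bool" where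
  "trivial_extension C I H \<eta> \<E> f \<longleftrightarrow> f \<in> \<E> \<and>
     is_pullback C (FMor H (FMor I f)) (\<eta> (Cod C f)) (\<eta> (Dom C f)) f"

definition normal_extension :: "('o, 'm) cat \<Rightarrow> ('o, 'm, 'p, 'n) functr
    \<Rightarrow> ('p, 'n, 'o, 'm) functr \<Rightarrow> ('o \<Rightarrow> 'm) \<Rightarrow> 'm set \<Rightarrow> 'm \<Rightarrow> bool" where
  "normal_extension C I H \<eta> \<E> f \<longleftrightarrow> f \<in> \<E> \<and>
     (\<forall>p q. is_kernel_pair C f p q \<longrightarrow>
        trivial_extension C I H \<eta> \<E> p \<and> trivial_extension C I H \<eta> \<E> q)"

definition Norm_over :: "('o, 'm) cat \<Rightarrow> ('o, 'm, 'p, 'n) functr \<Rightarrow> ('p, 'n, 'o, 'm) functr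
    \<Rightarrow> ('o \<Rightarrow> 'm) \<Rightarrow> 'm set \<Rightarrow> 'o \<Rightarrow> ('m, 'm \<times> 'm \<times> 'm) cat" where
  "Norm_over C I H \<eta> \<E> b =
     full_subcat (fib_over C \<E> b) {f. normal_extension C I H \<eta> \<E> f}"

definition Norm :: "('o, 'm) cat \<Rightarrow> ('o, 'm, 'p, 'n) functr \<Rightarrow> ('p, 'n, 'o, 'm) functr
    \<Rightarrow> ('o \<Rightarrow> 'm) \<Rightarrow> 'm set \<Rightarrow> ('m, 'm \<times> ('m \<times> 'm) \<times> 'm) cat" where
  "Norm C I H \<eta> \<E> = full_subcat (Fib C \<E>) {f. normal_extension C I H \<eta> \<E> f}"

end

theory Submission
  imports Defs
begin

text \<open>
  Let \<open>f : A \<rightarrow> B\<close> be a fibration with kernel pair \<open>p\<^sub>1, p\<^sub>2 : K \<rightarrow> A\<close>. After pulling back along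
  itself, \<open>f\<close> becomes \<open>p\<^sub>1\<close>, and there trivial extensions suffice: if \<open>n\<close> is normal and \<open>f\<close> maps to
  \<open>n\<close> with base component \<open>\<beta>\<close>, then the pullback of \<open>n\<close> along \<open>\<beta> \<cdot> f\<close> is a trivial extension
  of \<open>A\<close>, because \<open>\<beta> \<cdot> f\<close> lifts through \<open>n\<close> and so this is a pullback of a kernel pair projection of \<open>n\<close>
  (\<open>normal_pullback_along_lift_trivial\<close>). So the normal reflection of \<open>f\<close> is found by reflecting
  \<open>p\<^sub>1\<close> into the trivial extensions and descending the result along \<open>f\<close>.

  Admissibility provides that reflection. For a fibration \<open>e : D \<rightarrow> B\<close> let \<open>T(e)\<close> be the
  pullback of \<open>HI(e)\<close> along \<open>\<eta>\<^sub>B\<close>, with unit \<open>u\<^sub>e\<close> from \<open>e\<close>. Fullness of \<open>H\<^sup>B\<close>, applied to the unit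
  of \<open>T(e)\<close>, shows that \<open>\<eta>\<close> at the domain of \<open>T(e)\<close> is the projection to \<open>HI(D)\<close> followed by
  \<open>HI(u\<^sub>e)\<close> (\<open>\<eta>_triv_dom\<close>). It follows that \<open>T(e)\<close> is a trivial extension
  (\<open>trivial_extension_triv\<close>) and that maps from \<open>e\<close> to trivial extensions, over any map of bases,
  factor uniquely through it (\<open>triv_universal\<close>). Hence trivial extensions are pullback-stable, and
  \<open>T(e)\<close> also has the universal property for those maps to a normal extension \<open>n\<close> whose base
  component lifts through \<open>n\<close> (\<open>triv_universal_normal\<close>).

  In terms of elements, let \<open>S\<close> consist of the triples \<open>(x, y, z)\<close> with one image in \<open>B\<close>,
  let \<open>\<rho>\<close> send a triple to \<open>(x, y)\<close>, and let \<open>\<sigma>\<^sub>1, \<sigma>\<^sub>2\<close> send it to \<open>(x, z)\<close> and \<open>(y, z)\<close>. Then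
  \<open>\<rho> \<rightrightarrows> p\<^sub>1\<close> is a reflexive graph over \<open>p\<^sub>1, p\<^sub>2\<close> whose coequaliser is \<open>(p\<^sub>2, f) : p\<^sub>1 \<rightarrow> f\<close>.
  Apply \<open>T\<close>, and let \<open>n : Q \<rightarrow> B\<close> be the coequaliser of the graph \<open>T(\<rho>) \<rightrightarrows> T(p\<^sub>1)\<close>. The descent
  hypothesis says that \<open>n\<close> is normal. Given a map from \<open>f\<close> to a normal extension \<open>m\<close>, its
  composite with \<open>(p\<^sub>2, f)\<close> extends uniquely to \<open>T(p\<^sub>1)\<close>; the two restrictions to \<open>T(\<rho>)\<close> agree
  because they agree on \<open>\<rho>\<close>; so the map descends to \<open>n\<close> (\<open>normal_reflection\<close>). This is proved for
  arbitrary squares from \<open>f\<close> to \<open>m\<close>, so that it contains the universal property over the fixed base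
  \<open>B\<close> as well as that in the category of all fibrations.
\<close>

section \<open>Composition, pullbacks and coequalisers\<close>

context category
begin

lemma in_hom_iff: "f \<in> hom C a b \<longleftrightarrow> f \<in> Mor C \<and> Dom C f = a \<and> Cod C f = b"
  by (simp add: hom_def)

lemma hom_objs: "f \<in> hom C a b \<Longrightarrow> a \<in> Obj C \<and> b \<in> Obj C"
  using Dom_in Cod_in by (auto simp: hom_def)

lemma comp_hom [intro]: "\<lbrakk>f \<in> hom C a b; g \<in> hom C b c\<rbrakk> \<Longrightarrow> g \<cdot> f \<in> hom C a c"
  by (simp add: hom_def Comp_in Dom_Comp Cod_Comp)

lemma ident_hom [intro]: "a \<in> Obj C \<Longrightarrow> Ident C a \<in> hom C a a"
  by (simp add: hom_def Ident_in Dom_Ident Cod_Ident)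

lemma assoc: "\<lbrakk>f \<in> hom C a b; g \<in> hom C b c; h \<in> hom C c d\<rbrakk> \<Longrightarrow> (h \<cdot> g) \<cdot> f = h \<cdot> (g \<cdot> f)"
  by (simp add: hom_def Comp_assoc)

lemma ident_right: "f \<in> hom C a b \<Longrightarrow> f \<cdot> Ident C a = f"
  using Comp_Ident_right by (auto simp: hom_def)

lemma ident_left: "f \<in> hom C a b \<Longrightarrow> Ident C b \<cdot> f = f"
  using Comp_Ident_left by (auto simp: hom_def)

text \<open>With \<open>triangle_comp\<close>, this replaces rewriting modulo associativity: an equation between
  composites is applied at the head of a right-nested composite.\<close>
lemma square_comp:
  assumes "g \<cdot> f = g' \<cdot> f'" "x \<in> hom C z a" "f \<in> hom C a b" "g \<in> hom C b c"
    "f' \<in> hom C a b'" "g' \<in> hom C b' c"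
  shows "g \<cdot> (f \<cdot> x) = g' \<cdot> (f' \<cdot> x)"
  by (simp only: assms(1) assoc[OF assms(2-4), symmetric] assoc[OF assms(2,5,6), symmetric])

lemma triangle_comp:
  assumes "g \<cdot> f = h" "x \<in> hom C z a" "f \<in> hom C a b" "g \<in> hom C b c"
  shows "g \<cdot> (f \<cdot> x) = h \<cdot> x"
  by (simp only: assms(1) assoc[OF assms(2-4), symmetric])

lemma pullback_lift_ex1:
  assumes "is_pullback C f g p q" "a \<in> hom C z (Dom C f)" "b \<in> hom C z (Dom C g)"
    and "f \<cdot> a = g \<cdot> b"
  shows "\<exists>!u. u \<in> hom C z (Dom C p) \<and> p \<cdot> u = a \<and> q \<cdot> u = b"
proof -
  have ab: "a \<in> Mor C" "b \<in> Mor C" "Dom C a = z" "Dom C b = z" "Cod C a = Dom C f" "Cod C b = Dom C g"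
    using assms(2,3) by (auto simp: in_hom_iff)
  have univ: "\<forall>a\<in>Mor C. \<forall>b\<in>Mor C.
      Dom C a = Dom C b \<and> Cod C a = Dom C f \<and> Cod C b = Dom C g \<and> f \<cdot> a = g \<cdot> b \<longrightarrow>
      (\<exists>!u. u \<in> hom C (Dom C a) (Dom C p) \<and> p \<cdot> u = a \<and> q \<cdot> u = b)"
    using assms(1) unfolding is_pullback_def by (elim conjE)
  have "\<exists>!u. u \<in> hom C (Dom C a) (Dom C p) \<and> p \<cdot> u = a \<and> q \<cdot> u = b"
    by (rule univ[rule_format]) (simp_all add: ab assms(4))
  then show ?thesis
    by (simp only: ab)
qed

lemma pullback_lift:
  assumes "is_pullback C f g p q" "a \<in> hom C z (Dom C f)" "b \<in> hom C z (Dom C g)"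
    and "f \<cdot> a = g \<cdot> b"
  obtains u where "u \<in> hom C z (Dom C p)" "p \<cdot> u = a" "q \<cdot> u = b"
  using pullback_lift_ex1[OF assms] by blast

lemma pullback_lift_unique:
  assumes pb: "is_pullback C f g p q"
    and u: "u \<in> hom C z (Dom C p)" and v: "v \<in> hom C z (Dom C p)"
    and eqs: "p \<cdot> u = p \<cdot> v" "q \<cdot> u = q \<cdot> v"
  shows "u = v"
proof -
  have P: "p \<in> hom C (Dom C p) (Dom C f)" "q \<in> hom C (Dom C p) (Dom C g)"
    "f \<in> hom C (Dom C f) (Cod C f)" "g \<in> hom C (Dom C g) (Cod C f)" "f \<cdot> p = g \<cdot> q"
    using pb by (auto simp: is_pullback_def hom_def)
  have pu: "p \<cdot> u \<in> hom C z (Dom C f)" "q \<cdot> u \<in> hom C z (Dom C g)"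
    using P u by auto
  moreover have "f \<cdot> (p \<cdot> u) = g \<cdot> (q \<cdot> u)"
    using P u square_comp by blast
  ultimately have "\<exists>!w. w \<in> hom C z (Dom C p) \<and> p \<cdot> w = p \<cdot> u \<and> q \<cdot> w = q \<cdot> u"
    by (metis pullback_lift_ex1[OF pb])
  then show ?thesis
    using u v eqs by metis
qed

lemma pullbackI:
  assumes "f \<in> hom C a c" "g \<in> hom C b c" "p \<in> hom C d a" "q \<in> hom C d b" "f \<cdot> p = g \<cdot> q"
    and "\<And>z x y. \<lbrakk>x \<in> hom C z a; y \<in> hom C z b; f \<cdot> x = g \<cdot> y\<rbrakk>
      \<Longrightarrow> \<exists>u. u \<in> hom C z d \<and> p \<cdot> u = x \<and> q \<cdot> u = y"
    and "\<And>z u v. \<lbrakk>u \<in> hom C z d; v \<in> hom C z d; p \<cdot> u = p \<cdot> v; q \<cdot> u = q \<cdot> v\<rbrakk> \<Longrightarrow> u = v"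
  shows "is_pullback C f g p q"
proof -
  have "\<exists>!u. u \<in> hom C (Dom C x) (Dom C p) \<and> p \<cdot> u = x \<and> q \<cdot> u = y"
    if "x \<in> Mor C" "y \<in> Mor C" "Dom C x = Dom C y" "Cod C x = Dom C f" "Cod C y = Dom C g"
      and eq: "f \<cdot> x = g \<cdot> y" for x y
  proof -
    have xy: "x \<in> hom C (Dom C x) a" "y \<in> hom C (Dom C x) b"
      using that assms(1,2) by (auto simp: in_hom_iff)
    have [simp]: "Dom C p = d"
      using assms(3) by (simp add: in_hom_iff)
    obtain u where "u \<in> hom C (Dom C x) d" "p \<cdot> u = x" "q \<cdot> u = y"
      using assms(6)[OF xy eq] by blast
    then show ?thesis
      using assms(7) by (intro ex1I[of _ u]) auto
  qed
  then show ?thesis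
    using assms(1-5) unfolding is_pullback_def in_hom_iff by simp
qed

lemma pullbackD:
  assumes "is_pullback C f g p q"
  shows "f \<in> hom C (Dom C f) (Cod C f)" "g \<in> hom C (Dom C g) (Cod C f)"
    "p \<in> hom C (Dom C p) (Dom C f)" "q \<in> hom C (Dom C p) (Dom C g)" "f \<cdot> p = g \<cdot> q"
  using assms by (auto simp: is_pullback_def in_hom_iff)

lemma pullback_swap:
  assumes "is_pullback C f g p q"
  shows "is_pullback C g f q p"
proof (rule pullbackI)
  note P = pullbackD[OF assms]
  show "g \<in> hom C (Dom C g) (Cod C f)" "f \<in> hom C (Dom C f) (Cod C f)"
    "q \<in> hom C (Dom C p) (Dom C g)" "p \<in> hom C (Dom C p) (Dom C f)" "g \<cdot> q = f \<cdot> p"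
    using P by simp_all
  show "\<exists>u. u \<in> hom C z (Dom C p) \<and> q \<cdot> u = x \<and> p \<cdot> u = y"
    if "x \<in> hom C z (Dom C g)" "y \<in> hom C z (Dom C f)" "g \<cdot> x = f \<cdot> y" for z x y
    using pullback_lift_ex1[OF assms that(2,1) that(3)[symmetric]] by blast
  show "u = v" if "u \<in> hom C z (Dom C p)" "v \<in> hom C z (Dom C p)" "q \<cdot> u = q \<cdot> v" "p \<cdot> u = p \<cdot> v"
    for z u v
    using pullback_lift_unique[OF assms that(1,2,4,3)] .
qed

lemma coequaliser_epi:
  assumes "is_coequaliser C d c q" "u \<in> hom C (Cod C q) z" "v \<in> hom C (Cod C q) z" "u \<cdot> q = v \<cdot> q"
  shows "u = v"
proof -
  have q: "q \<in> hom C (Cod C d) (Cod C q)" "d \<in> hom C (Dom C d) (Cod C d)" "c \<in> hom C (Dom C d) (Cod C d)"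
    "q \<cdot> d = q \<cdot> c"
    using assms(1) by (auto simp: is_coequaliser_def parallel_def in_hom_iff)
  have "u \<cdot> q \<in> hom C (Cod C d) z" using q assms by auto
  moreover have "(u \<cdot> q) \<cdot> d = (u \<cdot> q) \<cdot> c"
    using q assms(2) by (simp add: assoc[OF q(2,1)] assoc[OF q(3,1)])
  ultimately have "\<exists>!w. w \<in> hom C (Cod C q) z \<and> w \<cdot> q = u \<cdot> q"
    using assms(1) unfolding is_coequaliser_def in_hom_iff by metis
  then show ?thesis using assms by metis
qed

lemma coequaliser_factor:
  assumes "is_coequaliser C d c q" "k \<in> hom C (Cod C d) z" "k \<cdot> d = k \<cdot> c"
  obtains u where "u \<in> hom C (Cod C q) z" "u \<cdot> q = k"
  using assms unfolding is_coequaliser_def in_hom_iff by metis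

lemma coequaliserI:
  assumes "d \<in> hom C r a" "c \<in> hom C r a" "q \<in> hom C a b" "q \<cdot> d = q \<cdot> c"
    and "\<And>z k. \<lbrakk>k \<in> hom C a z; k \<cdot> d = k \<cdot> c\<rbrakk> \<Longrightarrow> \<exists>!u. u \<in> hom C b z \<and> u \<cdot> q = k"
  shows "is_coequaliser C d c q"
  using assms unfolding is_coequaliser_def parallel_def by (auto simp: in_hom_iff)

text \<open>Whatever pair \<open>f\<close> coequalises factors through its kernel pair, so a map that identifies
  \<open>p\<close> and \<open>q\<close> identifies that pair too.\<close>
lemma regular_epi_coequaliser_of_kernel_pair:
  assumes "regular_epi C f" "is_kernel_pair C f p q"
  shows "is_coequaliser C p q f"
proof -
  obtain d c where co: "is_coequaliser C d c f"
    using assms(1) by (auto simp: regular_epi_def)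
  have pb: "is_pullback C f f p q"
    using assms(2) by (simp add: is_kernel_pair_def)
  note P = pullbackD[OF pb]
  have f: "Cod C d = Dom C f" "f \<cdot> d = f \<cdot> c" and
    dc: "d \<in> hom C (Dom C d) (Dom C f)" "c \<in> hom C (Dom C d) (Dom C f)"
    using co by (auto simp: is_coequaliser_def parallel_def in_hom_iff)
  obtain w where w: "w \<in> hom C (Dom C d) (Dom C p)" "p \<cdot> w = d" "q \<cdot> w = c"
    by (rule pullback_lift[OF pb dc f(2)])
  show ?thesis
  proof (rule coequaliserI[OF P(3) P(4) P(1) P(5)])
    fix z k assume k: "k \<in> hom C (Dom C f) z" "k \<cdot> p = k \<cdot> q"
    have "k \<cdot> d = k \<cdot> c"
      using square_comp[OF k(2) w(1) P(3) k(1) P(4) k(1)] w by simp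
    then obtain u where "u \<in> hom C (Cod C f) z" "u \<cdot> f = k"
      using coequaliser_factor[OF co] k f by metis
    then show "\<exists>!u. u \<in> hom C (Cod C f) z \<and> u \<cdot> f = k"
      using coequaliser_epi[OF co] by blast
  qed
qed

end

lemma ex1_unique: "\<lbrakk>\<exists>!x. P x; P a; P b\<rbrakk> \<Longrightarrow> a = b"
  by blast

context category
begin

lemma ident_simps:
  "\<lbrakk>f \<in> Mor C; Dom C f = a\<rbrakk> \<Longrightarrow> f \<cdot> Ident C a = f"
  "\<lbrakk>f \<in> Mor C; Cod C f = b\<rbrakk> \<Longrightarrow> Ident C b \<cdot> f = f"
  using Comp_Ident_right Comp_Ident_left by auto

lemmas comp_simps = Comp_in Dom_Comp Cod_Comp Comp_assoc ident_simps

text \<open>A form of \<open>triangle_comp\<close> for the simplifier, whose side conditions on \<open>x\<close> have no variables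
  that the left-hand side does not determine.\<close>
lemma reassoc:
  assumes "g \<cdot> f = h" "f \<in> hom C a b" "g \<in> hom C b c" "x \<in> Mor C" "Cod C x = a"
  shows "g \<cdot> (f \<cdot> x) = h \<cdot> x"
  using assms Comp_assoc[of x f g] by (simp add: in_hom_iff)

end

text \<open>The shape \<open>0 \<rightarrow> 2 \<leftarrow> 1\<close>: morphisms \<open>0, 1, 2\<close> are the identities, \<open>3\<close> and \<open>4\<close> the legs.
  In a composite of two morphisms at least one is an identity, which explains the formula for composition.\<close>
definition cospan :: "(nat, nat) cat" where
  "cospan = \<lparr>Obj = {0, 1, 2}, Mor = {0, 1, 2, 3, 4},
     Dom = (\<lambda>j. if j = 3 then 0 else if j = 4 then 1 else j),
     Cod = (\<lambda>j. if j = 3 \<or> j = 4 then 2 else j),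
     Ident = (\<lambda>i. i),
     Comp = (\<lambda>j i. if j < 3 then i else j)\<rparr>"

lemma cospan_category: "category cospan"
  by unfold_locales (auto simp: cospan_def split: if_splits)

lemma (in regular_category) pullback_exists:
  assumes f: "f \<in> hom C a c" and g: "g \<in> hom C b c"
  obtains p q where "is_pullback C f g p q"
proof -
  define D where "D = \<lparr>FObj = (\<lambda>i::nat. if i = 0 then a else if i = 1 then b else c),
    FMor = (\<lambda>j::nat. if j = 0 then Ident C a else if j = 1 then Ident C b
      else if j = 2 then Ident C c else if j = 3 then f else g)\<rparr>"
  have obs: "a \<in> Obj C" "b \<in> Obj C" "c \<in> Obj C"
    using f g hom_objs by auto
  interpret J: category cospan by (rule cospan_category)
  have "is_functor cospan C D"
  proof
  qed (use f g obs in \<open>auto simp: cospan_def D_def in_hom_iff Ident_in Dom_Ident Cod_Ident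
      ident_left[OF f] ident_left[OF g] ident_right[OF f] ident_right[OF g]
      ident_left[OF ident_hom] split: if_splits\<close>)
  moreover have "finite (Obj cospan)" "finite (Mor cospan)"
    by (auto simp: cospan_def)
  ultimately obtain l t where lim: "is_limit cospan C D l t"
    using finite_limits unfolding finitely_complete_def by blast
  have cone: "is_cone cospan C D l t" using lim by (simp add: is_limit_def)
  have t: "t 0 \<in> hom C l a" "t 1 \<in> hom C l b" "t 2 \<in> hom C l c" "f \<cdot> t 0 = t 2" "g \<cdot> t 1 = t 2"
    using cone by (auto simp: is_cone_def cospan_def D_def split: if_splits)
  have cone_iff: "is_cone cospan C D z s \<longleftrightarrow> z \<in> Obj C \<and> s 0 \<in> hom C z a \<and> s 1 \<in> hom C z b \<and> s 2 \<in> hom C z c \<and>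
     f \<cdot> s 0 = s 2 \<and> g \<cdot> s 1 = s 2" for z s
    by (auto simp: is_cone_def cospan_def D_def ident_left)
  have "is_pullback C f g (t 0) (t 1)"
  proof (rule pullbackI[OF f g t(1,2)])
    show "f \<cdot> t 0 = g \<cdot> t 1" using t by simp
  next
    fix z x y assume xy: "x \<in> hom C z a" "y \<in> hom C z b" "f \<cdot> x = g \<cdot> y"
    define s where "s = (\<lambda>i::nat. if i = 0 then x else if i = 1 then y else f \<cdot> x)"
    have "is_cone cospan C D z s"
      unfolding cone_iff using xy f g hom_objs by (auto simp: s_def)
    then obtain u where "u \<in> hom C z l" "\<forall>i\<in>Obj cospan. t i \<cdot> u = s i"
      using lim unfolding is_limit_def by blast
    then show "\<exists>u. u \<in> hom C z l \<and> t 0 \<cdot> u = x \<and> t 1 \<cdot> u = y"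
      by (auto simp: s_def cospan_def)
  next
    fix z u v assume uv: "u \<in> hom C z l" "v \<in> hom C z l" "t 0 \<cdot> u = t 0 \<cdot> v" "t 1 \<cdot> u = t 1 \<cdot> v"
    define s where "s = (\<lambda>i. t i \<cdot> u)"
    have "is_cone cospan C D z s"
      unfolding cone_iff s_def
      using uv(1) t hom_objs[OF uv(1)] triangle_comp[OF t(4) uv(1) t(1) f] triangle_comp[OF t(5) uv(1) t(2) g]
      by auto
    then have "\<exists>!w. w \<in> hom C z l \<and> (\<forall>i\<in>Obj cospan. t i \<cdot> w = s i)"
      using lim by (auto simp: is_limit_def)
    moreover have "t 2 \<cdot> u = t 2 \<cdot> v"
      using uv triangle_comp[OF t(4) uv(1) t(1) f] triangle_comp[OF t(4) uv(2) t(1) f] by simp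
    then have "\<forall>i\<in>Obj cospan. t i \<cdot> v = s i"
      using uv by (auto simp: s_def cospan_def)
    ultimately show "u = v"
      using uv by (auto simp: s_def)
  qed
  then show thesis by (rule that)
qed

context regular_category
begin

text \<open>In terms of elements, \<open>S\<close> consists of the triples \<open>(x, y, z)\<close> with \<open>f x = f y = f z\<close>, and
  \<open>\<sigma>\<^sub>1, \<sigma>\<^sub>2, \<rho>\<close> send such a triple to \<open>(x, z)\<close>, \<open>(y, z)\<close> and \<open>(x, y)\<close>. The common section is
  \<open>\<sigma> (x, z) = (x, x, z)\<close>. The map \<open>\<zeta> (x, z) = (x, z, z)\<close> exhibits \<open>p\<^sub>2\<close> as a split coequaliser
  of \<open>\<sigma>\<^sub>1\<close> and \<open>\<sigma>\<^sub>2\<close>, with splitting \<open>\<delta>\<close>: a map that identifies \<open>\<sigma>\<^sub>1\<close> and \<open>\<sigma>\<^sub>2\<close> cannot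
  tell \<open>(x, z)\<close> from \<open>(z, z)\<close>. As an object, \<open>S\<close> is constructed as the kernel pair of \<open>p\<^sub>2\<close>.\<close>
lemma kernel_pair_graph:
  assumes f: "f \<in> hom C a b" and kp: "is_kernel_pair C f p\<^sub>1 p\<^sub>2" and K: "Dom C p\<^sub>1 = K"
  obtains S \<delta> \<sigma>\<^sub>1 \<sigma>\<^sub>2 \<rho> \<sigma> \<zeta> where
    "\<delta> \<in> hom C a K" "p\<^sub>1 \<cdot> \<delta> = Ident C a" "p\<^sub>2 \<cdot> \<delta> = Ident C a"
    "\<sigma>\<^sub>1 \<in> hom C S K" "\<sigma>\<^sub>2 \<in> hom C S K" "\<rho> \<in> hom C S K" "\<sigma> \<in> hom C K S" "\<zeta> \<in> hom C K S"
    "p\<^sub>1 \<cdot> \<sigma>\<^sub>1 = p\<^sub>1 \<cdot> \<rho>" "p\<^sub>1 \<cdot> \<sigma>\<^sub>2 = p\<^sub>2 \<cdot> \<rho>" "p\<^sub>2 \<cdot> \<sigma>\<^sub>1 = p\<^sub>2 \<cdot> \<sigma>\<^sub>2"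
    "is_pullback C p\<^sub>1 p\<^sub>1 \<sigma>\<^sub>1 \<rho>"
    "\<sigma>\<^sub>1 \<cdot> \<sigma> = Ident C K" "\<sigma>\<^sub>2 \<cdot> \<sigma> = Ident C K" "\<rho> \<cdot> \<sigma> = \<delta> \<cdot> p\<^sub>1"
    "\<sigma>\<^sub>1 \<cdot> \<zeta> = Ident C K" "\<sigma>\<^sub>2 \<cdot> \<zeta> = \<delta> \<cdot> p\<^sub>2"
proof -
  have pb: "is_pullback C f f p\<^sub>1 p\<^sub>2" using kp by (simp add: is_kernel_pair_def)
  have a: "Dom C f = a" using f by (simp add: in_hom_iff)
  have p: "p\<^sub>1 \<in> hom C K a" "p\<^sub>2 \<in> hom C K a" and fp: "f \<cdot> p\<^sub>1 = f \<cdot> p\<^sub>2"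
    using pullbackD[OF pb] by (simp_all add: a K)
  note lift = pullback_lift_ex1[OF pb, unfolded a K] and uniq = pullback_lift_unique[OF pb, unfolded K]
  note obs = hom_objs[OF f] hom_objs[OF p(1)]
  obtain \<delta> where \<delta>: "\<delta> \<in> hom C a K" "p\<^sub>1 \<cdot> \<delta> = Ident C a" "p\<^sub>2 \<cdot> \<delta> = Ident C a"
    using lift[of "Ident C a" a "Ident C a"] obs by blast
  obtain \<sigma>\<^sub>1 \<sigma>\<^sub>2 where pb2: "is_pullback C p\<^sub>2 p\<^sub>2 \<sigma>\<^sub>1 \<sigma>\<^sub>2"
    using pullback_exists[OF p(2) p(2)] by blast
  define S where "S = Dom C \<sigma>\<^sub>1"
  have K2: "Dom C p\<^sub>2 = K" using p by (simp add: in_hom_iff)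
  have s: "\<sigma>\<^sub>1 \<in> hom C S K" "\<sigma>\<^sub>2 \<in> hom C S K" and ps: "p\<^sub>2 \<cdot> \<sigma>\<^sub>1 = p\<^sub>2 \<cdot> \<sigma>\<^sub>2"
    using pullbackD[OF pb2] by (simp_all add: K2 S_def)
  note lift2 = pullback_lift_ex1[OF pb2, unfolded K2, folded S_def]
    and uniq2 = pullback_lift_unique[OF pb2, folded S_def]
  note t = f[unfolded in_hom_iff] p[unfolded in_hom_iff] \<delta>(1)[unfolded in_hom_iff] s[unfolded in_hom_iff]
  have "f \<cdot> (p\<^sub>1 \<cdot> \<sigma>\<^sub>1) = f \<cdot> (p\<^sub>1 \<cdot> \<sigma>\<^sub>2)"
    by (simp add: t comp_simps reassoc[OF fp p(1) f] ps)
  then obtain \<rho> where \<rho>: "\<rho> \<in> hom C S K" "p\<^sub>1 \<cdot> \<rho> = p\<^sub>1 \<cdot> \<sigma>\<^sub>1" "p\<^sub>2 \<cdot> \<rho> = p\<^sub>1 \<cdot> \<sigma>\<^sub>2"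
    using lift[OF comp_hom[OF s(1) p(1)] comp_hom[OF s(2) p(1)]] by blast
  obtain \<sigma> where \<sigma>: "\<sigma> \<in> hom C K S" "\<sigma>\<^sub>1 \<cdot> \<sigma> = Ident C K" "\<sigma>\<^sub>2 \<cdot> \<sigma> = Ident C K"
    using lift2[of "Ident C K" K "Ident C K"] obs by blast
  have "p\<^sub>2 \<cdot> Ident C K = p\<^sub>2 \<cdot> (\<delta> \<cdot> p\<^sub>2)"
    by (simp add: t comp_simps reassoc[OF \<delta>(3,1) p(2)])
  then obtain \<zeta> where \<zeta>: "\<zeta> \<in> hom C K S" "\<sigma>\<^sub>1 \<cdot> \<zeta> = Ident C K" "\<sigma>\<^sub>2 \<cdot> \<zeta> = \<delta> \<cdot> p\<^sub>2"
    using lift2[OF ident_hom comp_hom[OF p(2) \<delta>(1)]] obs by blast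
  note t = t \<rho>(1)[unfolded in_hom_iff] \<sigma>(1)[unfolded in_hom_iff]
  have \<rho>\<sigma>: "\<rho> \<cdot> \<sigma> = \<delta> \<cdot> p\<^sub>1"
    by (rule uniq[OF comp_hom[OF \<sigma>(1) \<rho>(1)] comp_hom[OF p(1) \<delta>(1)]])
      (simp_all add: t comp_simps reassoc[OF \<rho>(2,1) p(1)] reassoc[OF \<rho>(3,1) p(2)]
        reassoc[OF \<delta>(2,1) p(1)] reassoc[OF \<delta>(3,1) p(2)] \<sigma>)
  have "is_pullback C p\<^sub>1 p\<^sub>1 \<sigma>\<^sub>1 \<rho>"
  proof (rule pullbackI[OF p(1) p(1) s(1) \<rho>(1) \<rho>(2)[symmetric]])
    fix z x y assume x: "x \<in> hom C z K" and y: "y \<in> hom C z K" and xy: "p\<^sub>1 \<cdot> x = p\<^sub>1 \<cdot> y"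
    note t = t x[unfolded in_hom_iff] y[unfolded in_hom_iff]
    \<comment> \<open>If \<open>x = (a, c)\<close> and \<open>y = (a, b)\<close>, the triple sought is \<open>(a, b, c)\<close>, and \<open>w\<close> is \<open>(b, c)\<close>.\<close>
    have "f \<cdot> (p\<^sub>2 \<cdot> y) = f \<cdot> (p\<^sub>2 \<cdot> x)"
      by (simp add: t comp_simps reassoc[OF fp[symmetric] p(2) f] xy)
    then obtain w where w: "w \<in> hom C z K" "p\<^sub>1 \<cdot> w = p\<^sub>2 \<cdot> y" "p\<^sub>2 \<cdot> w = p\<^sub>2 \<cdot> x"
      using lift[OF comp_hom[OF y p(2)] comp_hom[OF x p(2)]] by blast
    then obtain u where u: "u \<in> hom C z S" "\<sigma>\<^sub>1 \<cdot> u = x" "\<sigma>\<^sub>2 \<cdot> u = w"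
      using lift2[OF x w(1)] by auto
    note t = t u(1)[unfolded in_hom_iff]
    have "\<rho> \<cdot> u = y"
      by (rule uniq[OF comp_hom[OF u(1) \<rho>(1)] y])
        (simp_all add: t comp_simps reassoc[OF \<rho>(2,1) p(1)] reassoc[OF \<rho>(3,1) p(2)] u w xy)
    then show "\<exists>u. u \<in> hom C z S \<and> \<sigma>\<^sub>1 \<cdot> u = x \<and> \<rho> \<cdot> u = y"
      using u by blast
  next
    fix z u v
    assume u: "u \<in> hom C z S" and v: "v \<in> hom C z S" and eq: "\<sigma>\<^sub>1 \<cdot> u = \<sigma>\<^sub>1 \<cdot> v" "\<rho> \<cdot> u = \<rho> \<cdot> v"
    note t = t u[unfolded in_hom_iff] v[unfolded in_hom_iff]
    have "\<sigma>\<^sub>2 \<cdot> u = \<sigma>\<^sub>2 \<cdot> v"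
      by (rule uniq[OF comp_hom[OF u s(2)] comp_hom[OF v s(2)]])
        (simp_all add: t comp_simps reassoc[OF \<rho>(3)[symmetric] s(2) p(1)] reassoc[OF ps[symmetric] s(2) p(2)] eq)
    then show "u = v"
      using uniq2[OF u v eq(1)] by simp
  qed
  then show thesis
    using that[OF \<delta> s \<rho>(1) \<sigma>(1) \<zeta>(1) \<rho>(2)[symmetric] \<rho>(3)[symmetric] ps _ \<sigma>(2,3) \<rho>\<sigma> \<zeta>(2,3)] by blast
qed

end

section \<open>Reflections from universal arrows\<close>

lemma full_subcat_sel [simp]:
  "Obj (full_subcat C S) = Obj C \<inter> S"
  "Mor (full_subcat C S) = {f \<in> Mor C. Dom C f \<in> S \<and> Cod C f \<in> S}"
  "Dom (full_subcat C S) = Dom C" "Cod (full_subcat C S) = Cod C"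
  "Ident (full_subcat C S) = Ident C" "Comp (full_subcat C S) = Comp C"
  by (simp_all add: full_subcat_def)

lemma (in category) full_subcat_category: "category (full_subcat C S)"
  by unfold_locales
    (auto simp: Dom_in Cod_in Ident_in Dom_Ident Cod_Ident Comp_in Dom_Comp Cod_Comp
      Comp_Ident_left Comp_Ident_right Comp_assoc)

lemma inclusion_sel [simp]: "FObj inclusion = (\<lambda>a. a)" "FMor inclusion = (\<lambda>f. f)"
  by (simp_all add: inclusion_def)

lemma comp_functor_sel [simp]:
  "FObj (comp_functor G F) = (\<lambda>a. FObj G (FObj F a))"
  "FMor (comp_functor G F) = (\<lambda>f. FMor G (FMor F f))"
  by (simp_all add: comp_functor_def)

lemma is_functor_comp:
  assumes "is_functor A B F" "is_functor B D G"
  shows "is_functor A D (comp_functor G F)"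
proof -
  interpret F: is_functor A B F by (rule assms(1))
  interpret G: is_functor B D G by (rule assms(2))
  show ?thesis
    by unfold_locales
      (simp_all add: F.FObj_in F.FMor_in F.FMor_Dom F.FMor_Cod F.FMor_Ident F.FMor_Comp
        G.FObj_in G.FMor_in G.FMor_Dom G.FMor_Cod G.FMor_Ident G.FMor_Comp)
qed

lemma (in category) is_functor_identity: "is_functor C C inclusion"
  by unfold_locales simp_all

lemma (in category) is_functor_inclusion: "is_functor (full_subcat C S) C inclusion"
proof -
  interpret D: category "full_subcat C S" by (rule full_subcat_category)
  show ?thesis
    by unfold_locales simp_all
qed

text \<open>A universal arrow from each object determines a left adjoint of the inclusion: the equations
  that need an argument equate two arrows out of a reflection, and uniqueness of extensions
  allows checking them after composition with the universal arrow.\<close>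
lemma (in category) reflective_subcategory_if_universal_arrows:
  assumes univ: "\<And>a. a \<in> Obj C \<Longrightarrow> \<exists>k \<in> Mor C. Dom C k = a \<and> Cod C k \<in> S \<and>
      (\<forall>x \<in> S. \<forall>m \<in> hom C a x. \<exists>!u. u \<in> hom C (Cod C k) x \<and> u \<cdot> k = m)"
  shows "reflective_subcategory (full_subcat C S) C"
proof -
  let ?D = "full_subcat C S"
  have "\<forall>a\<in>Obj C. \<exists>k. k \<in> Mor C \<and> Dom C k = a \<and> Cod C k \<in> S \<and>
      (\<forall>x \<in> S. \<forall>m \<in> hom C a x. \<exists>!u. u \<in> hom C (Cod C k) x \<and> u \<cdot> k = m)"
    using univ by (simp add: Bex_def)
  from bchoice[OF this] obtain k where K: "\<forall>a\<in>Obj C. k a \<in> Mor C \<and> Dom C (k a) = a \<and> Cod C (k a) \<in> S \<and>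
      (\<forall>x \<in> S. \<forall>m \<in> hom C a x. \<exists>!u. u \<in> hom C (Cod C (k a)) x \<and> u \<cdot> k a = m)" ..
  define r where "r a = Cod C (k a)" for a
  have r: "r a \<in> S" "r a \<in> Obj C" and k: "k a \<in> hom C a (r a)"
    and ex1: "\<And>x m. \<lbrakk>x \<in> S; m \<in> hom C a x\<rbrakk> \<Longrightarrow> \<exists>!u. u \<in> hom C (r a) x \<and> u \<cdot> k a = m"
    if "a \<in> Obj C" for a
    using bspec[OF K that] Cod_in by (auto simp: r_def in_hom_iff)
  define ext where "ext a x m = (THE u. u \<in> hom C (r a) x \<and> u \<cdot> k a = m)" for a x m
  have ext: "ext a x m \<in> hom C (r a) x" "ext a x m \<cdot> k a = m"
    if "a \<in> Obj C" "x \<in> S" "m \<in> hom C a x" for a x m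
    using theI'[OF ex1[OF that]] by (auto simp: ext_def)
  have uniq: "u = v" if "u \<in> hom C (r a) x" "v \<in> hom C (r a) x" "u \<cdot> k a = v \<cdot> k a" "a \<in> Obj C" "x \<in> S"
    for u v a x
    using ex1[OF that(4,5), of "v \<cdot> k a"] that k by blast
  define L where "L = \<lparr>FObj = r, FMor = (\<lambda>f. ext (Dom C f) (r (Cod C f)) (k (Cod C f) \<cdot> f))\<rparr>"
  define \<epsilon> where "\<epsilon> x = ext x x (Ident C x)" for x
  have Lsel: "FObj L a = r a" for a by (simp add: L_def)
  have homs: "f \<in> hom C (Dom C f) (Cod C f)" "Dom C f \<in> Obj C" "Cod C f \<in> Obj C" if "f \<in> Mor C" for f
    using that Dom_in Cod_in by (auto simp: in_hom_iff)
  have LM: "FMor L f \<in> hom C (r (Dom C f)) (r (Cod C f))" "FMor L f \<cdot> k (Dom C f) = k (Cod C f) \<cdot> f"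
    if "f \<in> Mor C" for f
    using ext[OF homs(2)[OF that] r(1)[OF homs(3)[OF that]], of "k (Cod C f) \<cdot> f"]
      k[OF homs(3)[OF that]] homs(1)[OF that] by (auto simp: L_def)
  have \<epsilon>: "\<epsilon> x \<in> hom C (r x) x" "\<epsilon> x \<cdot> k x = Ident C x" if "x \<in> Obj C" "x \<in> S" for x
    using ext[OF that(1,2) ident_hom[OF that(1)]] by (auto simp: \<epsilon>_def)
  interpret D: category ?D by (rule full_subcat_category)
  interpret L: is_functor C ?D L
  proof
    show "FObj L a \<in> Obj ?D" if "a \<in> Obj C" for a
      using r that by (simp add: Lsel)
    show "FMor L f \<in> Mor ?D" "Dom ?D (FMor L f) = FObj L (Dom C f)" "Cod ?D (FMor L f) = FObj L (Cod C f)"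
      if "f \<in> Mor C" for f
      using LM(1)[OF that] r homs[OF that] by (auto simp: Lsel in_hom_iff)
    show "FMor L (Ident C a) = Ident ?D (FObj L a)" if a: "a \<in> Obj C" for a
    proof -
      note Li = LM[OF Ident_in[OF a], unfolded Dom_Ident[OF a] Cod_Ident[OF a]]
      have "FMor L (Ident C a) = Ident C (r a)"
        by (rule uniq[OF Li(1) ident_hom[OF r(2)[OF a]] _ a r(1)[OF a]])
          (simp add: Li(2) ident_left[OF k[OF a]] ident_right[OF k[OF a]])
      then show ?thesis by (simp add: Lsel)
    qed
    show "FMor L (g \<cdot> f) = FMor L g \<cdot>\<^bsub>?D\<^esub> FMor L f"
      if f: "f \<in> Mor C" and g: "g \<in> Mor C" and gf: "Cod C f = Dom C g" for f g
    proof -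
      have gf': "g \<cdot> f \<in> Mor C" "Dom C (g \<cdot> f) = Dom C f" "Cod C (g \<cdot> f) = Cod C g"
        using f g gf by (auto simp: Comp_in Dom_Comp Cod_Comp)
      note Lf = LM[OF f] and Lg = LM[OF g, folded gf] and Lgf = LM[OF gf'(1), unfolded gf']
      have kf: "k (Dom C f) \<in> hom C (Dom C f) (r (Dom C f))" "k (Cod C f) \<in> hom C (Cod C f) (r (Cod C f))"
        "k (Cod C g) \<in> hom C (Cod C g) (r (Cod C g))"
        using k homs f g by auto
      have "FMor L (g \<cdot> f) = FMor L g \<cdot> FMor L f"
      proof (rule uniq[OF Lgf(1)])
        have "(FMor L g \<cdot> FMor L f) \<cdot> k (Dom C f) = FMor L g \<cdot> (k (Cod C f) \<cdot> f)"
          using assoc[OF kf(1) Lf(1) Lg(1)] Lf(2) by simp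
        also have "\<dots> = k (Cod C g) \<cdot> (g \<cdot> f)"
          by (rule square_comp[OF Lg(2) homs(1)[OF f] kf(2) Lg(1) _ kf(3)])
            (use g gf in \<open>simp add: in_hom_iff\<close>)
        finally show "FMor L (g \<cdot> f) \<cdot> k (Dom C f) = (FMor L g \<cdot> FMor L f) \<cdot> k (Dom C f)"
          using Lgf(2) by simp
      qed (use Lf(1) Lg(1) homs r f g in auto)
      then show ?thesis by simp
    qed
  qed
  note functors = is_functor_identity is_functor_inclusion L.is_functor_axioms D.is_functor_identity
    is_functor_comp[OF L.is_functor_axioms is_functor_inclusion]
    is_functor_comp[OF is_functor_inclusion L.is_functor_axioms]
  have "adjunction C ?D L inclusion k \<epsilon>"
  proof (intro adjunction.intro nat_trans.intro nat_trans_axioms.intro adjunction_axioms.intro functors)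
    show "k a \<in> hom C (FObj inclusion a) (FObj (comp_functor inclusion L) a)" if "a \<in> Obj C" for a
      using k that by (simp add: Lsel)
    show "k (Cod C f) \<cdot> FMor inclusion f = FMor (comp_functor inclusion L) f \<cdot> k (Dom C f)"
      if "f \<in> Mor C" for f
      using LM(2)[OF that] by simp
    show "\<epsilon> x \<in> hom ?D (FObj (comp_functor L inclusion) x) (FObj inclusion x)" if "x \<in> Obj ?D" for x
      using \<epsilon>[of x] that r by (auto simp: Lsel hom_def)
    show "\<epsilon> (Cod ?D f) \<cdot>\<^bsub>?D\<^esub> FMor (comp_functor L inclusion) f = FMor inclusion f \<cdot>\<^bsub>?D\<^esub> \<epsilon> (Dom ?D f)"
      if "f \<in> Mor ?D" for f
    proof -
      have f: "f \<in> Mor C" "Dom C f \<in> S" "Cod C f \<in> S" using that by auto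
      note h = homs[OF f(1)] and Lf = LM[OF f(1)]
      note e = \<epsilon>[OF h(2) f(2)] \<epsilon>[OF h(3) f(3)]
      have "\<epsilon> (Cod C f) \<cdot> FMor L f = f \<cdot> \<epsilon> (Dom C f)"
      proof (rule uniq[OF _ _ _ h(2) f(3)])
        have "(\<epsilon> (Cod C f) \<cdot> FMor L f) \<cdot> k (Dom C f) = \<epsilon> (Cod C f) \<cdot> (k (Cod C f) \<cdot> f)"
          using assoc[OF k[OF h(2)] Lf(1) e(3)] Lf(2) by simp
        also have "\<dots> = f"
          using assoc[OF h(1) k[OF h(3)] e(3)] e(4) ident_left[OF h(1)] by simp
        also have "\<dots> = (f \<cdot> \<epsilon> (Dom C f)) \<cdot> k (Dom C f)"
          using assoc[OF k[OF h(2)] e(1) h(1)] e(2) ident_right[OF h(1)] by simp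
        finally show "(\<epsilon> (Cod C f) \<cdot> FMor L f) \<cdot> k (Dom C f) = (f \<cdot> \<epsilon> (Dom C f)) \<cdot> k (Dom C f)" .
      qed (use e Lf h in auto)
      then show ?thesis by simp
    qed
    show "\<epsilon> (FObj L a) \<cdot>\<^bsub>?D\<^esub> FMor L (k a) = Ident ?D (FObj L a)" if a: "a \<in> Obj C" for a
    proof -
      have ka: "k a \<in> Mor C" "Dom C (k a) = a" "Cod C (k a) = r a" using k[OF a] by (auto simp: in_hom_iff)
      note ra = r(2)[OF a] r(1)[OF a] and Lk = LM[OF ka(1), unfolded ka]
      note e = \<epsilon>[OF ra]
      have "\<epsilon> (r a) \<cdot> FMor L (k a) = Ident C (r a)"
      proof (rule uniq[OF _ _ _ a ra(2)])
        have "(\<epsilon> (r a) \<cdot> FMor L (k a)) \<cdot> k a = \<epsilon> (r a) \<cdot> (k (r a) \<cdot> k a)"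
          using assoc[OF k[OF a] Lk(1) e(1)] Lk(2) by simp
        also have "\<dots> = Ident C (r a) \<cdot> k a"
          using assoc[OF k[OF a] k[OF ra(1)] e(1)] e(2) by simp
        finally show "(\<epsilon> (r a) \<cdot> FMor L (k a)) \<cdot> k a = Ident C (r a) \<cdot> k a" .
      qed (use e Lk ra in auto)
      then show ?thesis by (simp add: Lsel)
    qed
    show "FMor inclusion (\<epsilon> x) \<cdot> k (FObj inclusion x) = Ident C (FObj inclusion x)" if "x \<in> Obj ?D" for x
      using \<epsilon>[of x] that by simp
  qed
  then show ?thesis
    unfolding reflective_subcategory_def by blast
qed

section \<open>Slice and arrow categories\<close>

lemma slice_sel [simp]:
  "f \<in> Obj (slice C b) \<longleftrightarrow> f \<in> Mor C \<and> Cod C f = b"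
  "(f, a, g) \<in> Mor (slice C b) \<longleftrightarrow> f \<in> Mor C \<and> g \<in> Mor C \<and> Cod C f = b \<and> Cod C g = b \<and>
     a \<in> hom C (Dom C f) (Dom C g) \<and> g \<cdot>\<^bsub>C\<^esub> a = f"
  "Dom (slice C b) (f, a, g) = f" "Cod (slice C b) (f, a, g) = g"
  "Ident (slice C b) f = (f, Ident C (Dom C f), f)"
  "(f', a', g') \<cdot>\<^bsub>slice C b\<^esub> (f, a, g) = (f, a' \<cdot>\<^bsub>C\<^esub> a, g')"
  by (simp_all add: slice_def)

lemma arrow_cat_sel [simp]:
  "Obj (arrow_cat C) = Mor C"
  "(f, (a, b), g) \<in> Mor (arrow_cat C) \<longleftrightarrow> f \<in> Mor C \<and> g \<in> Mor C \<and>
     a \<in> hom C (Dom C f) (Dom C g) \<and> b \<in> hom C (Cod C f) (Cod C g) \<and> g \<cdot>\<^bsub>C\<^esub> a = b \<cdot>\<^bsub>C\<^esub> f"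
  "Dom (arrow_cat C) (f, ab, g) = f" "Cod (arrow_cat C) (f, ab, g) = g"
  "Ident (arrow_cat C) f = (f, (Ident C (Dom C f), Ident C (Cod C f)), f)"
  "(f', (a', b'), g') \<cdot>\<^bsub>arrow_cat C\<^esub> (f, (a, b), g) = (f, (a' \<cdot>\<^bsub>C\<^esub> a, b' \<cdot>\<^bsub>C\<^esub> b), g')"
  by (simp_all add: arrow_cat_def)

context category
begin

lemma Mor_hom: "f \<in> Mor C \<Longrightarrow> f \<in> hom C (Dom C f) (Cod C f)"
  by (simp add: in_hom_iff)

lemma slice_category: "category (slice C b)"
proof
  fix t u v :: "'m \<times> 'm \<times> 'm"
  obtain t1 t2 t3 u1 u2 u3 v1 v2 v3 where tuv: "t = (t1, t2, t3)" "u = (u1, u2, u3)" "v = (v1, v2, v3)"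
    by (cases t, cases u, cases v) auto
  show "Dom (slice C b) t \<in> Obj (slice C b)" "Cod (slice C b) t \<in> Obj (slice C b)" if "t \<in> Mor (slice C b)"
    using that by (simp_all add: tuv)
  show "t \<cdot>\<^bsub>slice C b\<^esub> Ident (slice C b) (Dom (slice C b) t) = t"
    "Ident (slice C b) (Cod (slice C b) t) \<cdot>\<^bsub>slice C b\<^esub> t = t" if "t \<in> Mor (slice C b)"
    using that ident_left ident_right by (auto simp: tuv)
  assume tu: "t \<in> Mor (slice C b)" "u \<in> Mor (slice C b)" "Cod (slice C b) t = Dom (slice C b) u"
  have T: "t2 \<in> hom C (Dom C t1) (Dom C u1)" "u2 \<in> hom C (Dom C u1) (Dom C u3)" "u3 \<in> hom C (Dom C u3) b"
    "u3 \<cdot> u2 = u1" "u1 \<cdot> t2 = t1"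
    using tu by (simp_all add: tuv in_hom_iff)
  then have "u3 \<cdot> (u2 \<cdot> t2) = t1"
    using triangle_comp[OF T(4,1-3)] by simp
  then show "u \<cdot>\<^bsub>slice C b\<^esub> t \<in> Mor (slice C b)"
    using tu T(1,2) by (auto simp: tuv)
  show "Dom (slice C b) (u \<cdot>\<^bsub>slice C b\<^esub> t) = Dom (slice C b) t" "Cod (slice C b) (u \<cdot>\<^bsub>slice C b\<^esub> t) = Cod (slice C b) u"
    by (simp_all add: tuv)
  show "(v \<cdot>\<^bsub>slice C b\<^esub> u) \<cdot>\<^bsub>slice C b\<^esub> t = v \<cdot>\<^bsub>slice C b\<^esub> u \<cdot>\<^bsub>slice C b\<^esub> t"
    if "v \<in> Mor (slice C b)" "Cod (slice C b) u = Dom (slice C b) v"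
    using tu that by (auto simp: tuv assoc)
next
  fix f assume "f \<in> Obj (slice C b)"
  then show "Ident (slice C b) f \<in> Mor (slice C b)" "Dom (slice C b) (Ident (slice C b) f) = f"
    "Cod (slice C b) (Ident (slice C b) f) = f"
    using ident_right[OF Mor_hom] by (auto simp: Dom_in)
qed

lemma arrow_cat_category: "category (arrow_cat C)"
proof
  let ?A = "arrow_cat C"
  fix t u v :: "'m \<times> ('m \<times> 'm) \<times> 'm"
  obtain t1 t2 t3 t4 u1 u2 u3 u4 v1 v2 v3 v4 where tuv: "t = (t1, (t2, t3), t4)" "u = (u1, (u2, u3), u4)"
    "v = (v1, (v2, v3), v4)"
    by (cases t, cases u, cases v) auto
  show "Dom ?A t \<in> Obj ?A" "Cod ?A t \<in> Obj ?A" if "t \<in> Mor ?A"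
    using that by (simp_all add: tuv)
  show "t \<cdot>\<^bsub>?A\<^esub> Ident ?A (Dom ?A t) = t"
    "Ident ?A (Cod ?A t) \<cdot>\<^bsub>?A\<^esub> t = t" if "t \<in> Mor ?A"
    using that ident_left ident_right by (auto simp: tuv)
  assume tu: "t \<in> Mor ?A" "u \<in> Mor ?A" "Cod ?A t = Dom ?A u"
  have T: "t2 \<in> hom C (Dom C t1) (Dom C u1)" "t3 \<in> hom C (Cod C t1) (Cod C u1)"
    "t1 \<in> hom C (Dom C t1) (Cod C t1)" "u1 \<in> hom C (Dom C u1) (Cod C u1)" "u1 \<cdot> t2 = t3 \<cdot> t1"
    and U: "u2 \<in> hom C (Dom C u1) (Dom C u4)" "u3 \<in> hom C (Cod C u1) (Cod C u4)"
    "u4 \<in> hom C (Dom C u4) (Cod C u4)" "u4 \<cdot> u2 = u3 \<cdot> u1"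
    using tu by (auto simp: tuv Mor_hom)
  have "u4 \<cdot> (u2 \<cdot> t2) = (u3 \<cdot> t3) \<cdot> t1"
    using square_comp[OF U(4) T(1) U(1,3) T(4) U(2)] assoc[OF T(3,2) U(2)] T(5) by simp
  then show "u \<cdot>\<^bsub>?A\<^esub> t \<in> Mor ?A"
    using tu T U by (auto simp: tuv)
  show "Dom ?A (u \<cdot>\<^bsub>?A\<^esub> t) = Dom ?A t" "Cod ?A (u \<cdot>\<^bsub>?A\<^esub> t) = Cod ?A u"
    by (simp_all add: tuv)
  show "(v \<cdot>\<^bsub>?A\<^esub> u) \<cdot>\<^bsub>?A\<^esub> t = v \<cdot>\<^bsub>?A\<^esub> u \<cdot>\<^bsub>?A\<^esub> t"
    if "v \<in> Mor ?A" "Cod ?A u = Dom ?A v"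
    using tu that by (auto simp: tuv assoc)
next
  fix f assume "f \<in> Obj (arrow_cat C)"
  then show "Ident (arrow_cat C) f \<in> Mor (arrow_cat C)" "Dom (arrow_cat C) (Ident (arrow_cat C) f) = f"
    "Cod (arrow_cat C) (Ident (arrow_cat C) f) = f"
    using ident_right[OF Mor_hom] ident_left[OF Mor_hom] by (auto simp: Dom_in Cod_in)
qed

end

text \<open>Coequalisers in the arrow category are computed on domains and codomains separately. The
  square formed by the two induced maps commutes because \<open>g\<close> is epic.\<close>
lemma (in category) arrow_coequaliser:
  assumes dc: "is_coequaliser C d c g" and pq: "is_coequaliser C p q h"
    and D: "(f'', (d, p), f') \<in> Mor (arrow_cat C)" and D': "(f'', (c, q), f') \<in> Mor (arrow_cat C)"
    and G: "(f', (g, h), f) \<in> Mor (arrow_cat C)"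
  shows "is_coequaliser (arrow_cat C) (f'', (d, p), f') (f'', (c, q), f') (f', (g, h), f)"
proof -
  interpret A: category "arrow_cat C" by (rule arrow_cat_category)
  have d: "Cod C d = Dom C f'" "Cod C p = Cod C f'"
    and g: "g \<in> hom C (Dom C f') (Dom C f)" "h \<in> hom C (Cod C f') (Cod C f)" "f \<cdot> g = h \<cdot> f'"
    and f': "f' \<in> hom C (Dom C f') (Cod C f')" and f: "f \<in> hom C (Dom C f) (Cod C f)"
    and gd: "g \<cdot> d = g \<cdot> c" and hp: "h \<cdot> p = h \<cdot> q"
    using D G dc pq by (auto simp: in_hom_iff is_coequaliser_def)
  have gh: "Cod C g = Dom C f" "Cod C h = Cod C f" using g by (auto simp: in_hom_iff)
  show ?thesis
  proof (rule A.coequaliserI)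
    show "(f'', (d, p), f') \<in> hom (arrow_cat C) f'' f'" "(f'', (c, q), f') \<in> hom (arrow_cat C) f'' f'"
      "(f', (g, h), f) \<in> hom (arrow_cat C) f' f"
      using D D' G by (simp_all add: A.in_hom_iff)
    show "(f', (g, h), f) \<cdot>\<^bsub>arrow_cat C\<^esub> (f'', (d, p), f') = (f', (g, h), f) \<cdot>\<^bsub>arrow_cat C\<^esub> (f'', (c, q), f')"
      by (simp add: gd hp)
    fix z k
    assume "k \<in> hom (arrow_cat C) f' z"
      and eq: "k \<cdot>\<^bsub>arrow_cat C\<^esub> (f'', (d, p), f') = k \<cdot>\<^bsub>arrow_cat C\<^esub> (f'', (c, q), f')"
    then obtain x y where k: "k = (f', (x, y), z)" and kM: "(f', (x, y), z) \<in> Mor (arrow_cat C)"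
      by (cases k) (auto simp: A.in_hom_iff)
    have xy: "x \<in> hom C (Dom C f') (Dom C z)" "y \<in> hom C (Cod C f') (Cod C z)" "z \<cdot> x = y \<cdot> f'"
      and z: "z \<in> hom C (Dom C z) (Cod C z)"
      using kM by (simp_all add: Mor_hom)
    have "x \<cdot> d = x \<cdot> c" "y \<cdot> p = y \<cdot> q"
      using eq by (simp_all add: k)
    then obtain u w where u: "u \<in> hom C (Dom C f) (Dom C z)" "u \<cdot> g = x"
      and w: "w \<in> hom C (Cod C f) (Cod C z)" "w \<cdot> h = y"
      using coequaliser_factor[OF dc, unfolded d gh, OF xy(1)] coequaliser_factor[OF pq, unfolded d gh, OF xy(2)]
      by metis
    have "z \<cdot> u = w \<cdot> f"
    proof (rule coequaliser_epi[OF dc, unfolded gh, OF comp_hom[OF u(1) z] comp_hom[OF f w(1)]])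
      have "(z \<cdot> u) \<cdot> g = y \<cdot> f'"
        by (simp only: assoc[OF g(1) u(1) z] u(2) xy(3))
      also have "\<dots> = w \<cdot> (h \<cdot> f')"
        by (simp only: triangle_comp[OF w(2) f' g(2) w(1)])
      also have "\<dots> = (w \<cdot> f) \<cdot> g"
        by (simp only: g(3)[symmetric] assoc[OF g(1) f w(1)])
      finally show "(z \<cdot> u) \<cdot> g = (w \<cdot> f) \<cdot> g" .
    qed
    then have "(f, (u, w), z) \<in> hom (arrow_cat C) f z" "(f, (u, w), z) \<cdot>\<^bsub>arrow_cat C\<^esub> (f', (g, h), f) = k"
      using u w f z by (simp_all add: A.in_hom_iff k in_hom_iff)
    moreover have "r = (f, (u, w), z)"
      if r: "r \<in> hom (arrow_cat C) f z" "r \<cdot>\<^bsub>arrow_cat C\<^esub> (f', (g, h), f) = k" for r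
    proof -
      obtain u' w' where r': "r = (f, (u', w'), z)" "(f, (u', w'), z) \<in> Mor (arrow_cat C)"
        using r(1) by (cases r) (auto simp: A.in_hom_iff)
      have "u' \<cdot> g = u \<cdot> g" "w' \<cdot> h = w \<cdot> h"
        using r(2) by (simp_all add: r'(1) k u w)
      then have "u' = u" "w' = w"
        using coequaliser_epi[OF dc, unfolded gh, OF _ u(1)] coequaliser_epi[OF pq, unfolded gh, OF _ w(1)] r'(2)
        by simp_all
      then show ?thesis by (simp add: r'(1))
    qed
    ultimately show "\<exists>!u. u \<in> hom (arrow_cat C) f z \<and> u \<cdot>\<^bsub>arrow_cat C\<^esub> (f', (g, h), f) = k"
      by blast
  qed
qed

section \<open>Transposition along the adjunction\<close>

locale admissible_galois_structure = galois_structure C X I H \<eta> \<epsilon> \<E> \<F>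
  for C :: "('o, 'm) cat" (structure) and X :: "('p, 'n) cat" and I H \<eta> \<epsilon> \<E> \<F> +
  assumes admissible: "admissible C X I H \<eta> \<E> \<F>"
begin

abbreviation HI :: "'m \<Rightarrow> 'm" where "HI f \<equiv> FMor H (FMor I f)"

abbreviation HI\<^sub>o :: "'o \<Rightarrow> 'o" where "HI\<^sub>o a \<equiv> FObj H (FObj I a)"

lemma I_hom: "f \<in> hom C a b \<Longrightarrow> FMor I f \<in> hom X (FObj I a) (FObj I b)"
  by (auto simp: hom_def I.FMor_in I.FMor_Dom I.FMor_Cod)

lemma H_hom: "x \<in> hom X a b \<Longrightarrow> FMor H x \<in> hom C (FObj H a) (FObj H b)"
  by (auto simp: hom_def H.FMor_in H.FMor_Dom H.FMor_Cod)

lemma HI_hom: "f \<in> hom C a b \<Longrightarrow> HI f \<in> hom C (HI\<^sub>o a) (HI\<^sub>o b)"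
  by (intro H_hom I_hom)

lemma I_comp: "\<lbrakk>f \<in> hom C a b; g \<in> hom C b c\<rbrakk> \<Longrightarrow> FMor I (g \<cdot> f) = FMor I g \<cdot>\<^bsub>X\<^esub> FMor I f"
  by (simp add: hom_def I.FMor_Comp)

lemma H_comp: "\<lbrakk>f \<in> hom X a b; g \<in> hom X b c\<rbrakk> \<Longrightarrow> FMor H (g \<cdot>\<^bsub>X\<^esub> f) = FMor H g \<cdot> FMor H f"
  by (simp add: hom_def H.FMor_Comp)

lemma HI_comp: "\<lbrakk>f \<in> hom C a b; g \<in> hom C b c\<rbrakk> \<Longrightarrow> HI (g \<cdot> f) = HI g \<cdot> HI f"
  by (simp only: I_comp H_comp[OF I_hom I_hom])

lemma \<eta>_hom: "a \<in> Obj C \<Longrightarrow> \<eta> a \<in> hom C a (HI\<^sub>o a)"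
  using unit.component by simp

lemma \<epsilon>_hom: "x \<in> Obj X \<Longrightarrow> \<epsilon> x \<in> hom X (FObj I (FObj H x)) x"
  using counit.component by simp

lemma \<eta>_natural: "f \<in> hom C a b \<Longrightarrow> \<eta> b \<cdot> f = HI f \<cdot> \<eta> a"
  using unit.naturality[of f] by (auto simp: hom_def)

lemma \<epsilon>_natural: "x \<in> hom X a b \<Longrightarrow> \<epsilon> b \<cdot>\<^bsub>X\<^esub> FMor I (FMor H x) = x \<cdot>\<^bsub>X\<^esub> \<epsilon> a"
  using counit.naturality[of x] by (auto simp: hom_def)

text \<open>This and \<open>transpose_unique\<close> are the bijection between maps \<open>I(a) \<rightarrow> x\<close> and
  \<open>a \<rightarrow> H(x)\<close>, written in terms of the unit.\<close>
lemma transpose_exists: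
  assumes y: "y \<in> hom C a (FObj H x)" and x: "x \<in> Obj X"
  shows "\<exists>s \<in> hom X (FObj I a) x. FMor H s \<cdot> \<eta> a = y"
proof
  have a: "a \<in> Obj C" "FObj H x \<in> Obj C" using C.hom_objs[OF y] by auto
  show "\<epsilon> x \<cdot>\<^bsub>X\<^esub> FMor I y \<in> hom X (FObj I a) x"
    by (rule X.comp_hom[OF I_hom[OF y] \<epsilon>_hom[OF x]])
  have "FMor H (\<epsilon> x \<cdot>\<^bsub>X\<^esub> FMor I y) \<cdot> \<eta> a = FMor H (\<epsilon> x) \<cdot> (HI y \<cdot> \<eta> a)"
    by (simp only: H_comp[OF I_hom[OF y] \<epsilon>_hom[OF x]]
        C.assoc[OF \<eta>_hom[OF a(1)] HI_hom[OF y] H_hom[OF \<epsilon>_hom[OF x]]])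
  also have "\<dots> = (FMor H (\<epsilon> x) \<cdot> \<eta> (FObj H x)) \<cdot> y"
    by (simp only: \<eta>_natural[OF y, symmetric] C.assoc[OF y \<eta>_hom[OF a(2)] H_hom[OF \<epsilon>_hom[OF x]]])
  also have "\<dots> = y"
    by (simp only: triangle_H[OF x] C.ident_left[OF y])
  finally show "FMor H (\<epsilon> x \<cdot>\<^bsub>X\<^esub> FMor I y) \<cdot> \<eta> a = y" .
qed

lemma transpose_unique:
  assumes s: "s \<in> hom X (FObj I a) x" and s': "s' \<in> hom X (FObj I a) x" and a: "a \<in> Obj C"
    and eq: "FMor H s \<cdot> \<eta> a = FMor H s' \<cdot> \<eta> a"
  shows "s = s'"
proof -
  have recover: "\<epsilon> x \<cdot>\<^bsub>X\<^esub> FMor I (FMor H r \<cdot> \<eta> a) = r" if r: "r \<in> hom X (FObj I a) x" for r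
  proof -
    have obs: "FObj I a \<in> Obj X" "x \<in> Obj X" using X.hom_objs[OF r] by auto
    note eta = \<eta>_hom[OF a]
    have "\<epsilon> x \<cdot>\<^bsub>X\<^esub> FMor I (FMor H r \<cdot> \<eta> a) = \<epsilon> x \<cdot>\<^bsub>X\<^esub> (FMor I (FMor H r) \<cdot>\<^bsub>X\<^esub> FMor I (\<eta> a))"
      by (simp only: I_comp[OF eta H_hom[OF r]])
    also have "\<dots> = r \<cdot>\<^bsub>X\<^esub> (\<epsilon> (FObj I a) \<cdot>\<^bsub>X\<^esub> FMor I (\<eta> a))"
      by (rule X.square_comp[OF \<epsilon>_natural[OF r] I_hom[OF eta] I_hom[OF H_hom[OF r]] \<epsilon>_hom[OF obs(2)]
            \<epsilon>_hom[OF obs(1)] r])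
    also have "\<dots> = r"
      by (simp only: triangle_I[OF a] X.ident_right[OF r])
    finally show ?thesis .
  qed
  show ?thesis
    by (rule trans[OF recover[OF s, unfolded eq, symmetric] recover[OF s']])
qed

lemma E_hom: "e \<in> \<E> \<Longrightarrow> e \<in> hom C (Dom C e) (Cod C e)"
  using E_Mor by (auto simp: C.in_hom_iff)

end

section \<open>The reflection of fibrations into trivial extensions\<close>

context admissible_galois_structure
begin

text \<open>\<open>triv e\<close> is \<open>H\<^sup>B(I(e))\<close> for \<open>B\<close> the codomain of \<open>e\<close>. It uses the same choice of pullback as
  \<^const>\<open>H_over\<close>, so that fullness of \<open>H\<^sup>B\<close> speaks about this very object. The other projection of
  the pullback is \<open>triv_pr e\<close>, and \<open>triv_unit e\<close> is the map to the pullback induced by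
  the naturality square of \<open>\<eta>\<close> at \<open>e\<close>.\<close>
definition triv :: "'m \<Rightarrow> 'm" where
  "triv e = fst (chosen_pullback C (\<eta> (Cod C e)) (HI e))"

definition triv_pr :: "'m \<Rightarrow> 'm" where
  "triv_pr e = snd (chosen_pullback C (\<eta> (Cod C e)) (HI e))"

definition triv_unit :: "'m \<Rightarrow> 'm" where
  "triv_unit e = (THE u. u \<in> hom C (Dom C e) (Dom C (triv e)) \<and> triv e \<cdot> u = e \<and> triv_pr e \<cdot> u = \<eta> (Dom C e))"

abbreviation triv_dom :: "'m \<Rightarrow> 'o" where "triv_dom e \<equiv> Dom C (triv e)"

lemma triv_pullback:
  assumes e: "e \<in> hom C a b"
  shows "is_pullback C (\<eta> b) (HI e) (triv e) (triv_pr e)"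
proof -
  have b: "b \<in> Obj C" "Cod C e = b" using C.hom_objs[OF e] e by (auto simp: C.in_hom_iff)
  obtain p q where "is_pullback C (\<eta> b) (HI e) p q"
    using C.pullback_exists[OF \<eta>_hom[OF b(1)] HI_hom[OF e]] by blast
  then have "\<exists>pq. is_pullback C (\<eta> b) (HI e) (fst pq) (snd pq)" by auto
  from someI_ex[OF this] show ?thesis
    by (simp add: triv_def triv_pr_def chosen_pullback_def b)
qed

lemma triv_homs:
  assumes e: "e \<in> hom C a b"
  shows "triv e \<in> hom C (triv_dom e) b" "triv_pr e \<in> hom C (triv_dom e) (HI\<^sub>o a)"
    "\<eta> b \<cdot> triv e = HI e \<cdot> triv_pr e"
proof -
  have "Dom C (\<eta> b) = b" "Dom C (HI e) = HI\<^sub>o a"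
    using \<eta>_hom[of b] HI_hom[OF e] C.hom_objs[OF e] by (auto simp: C.in_hom_iff)
  then show "triv e \<in> hom C (triv_dom e) b" "triv_pr e \<in> hom C (triv_dom e) (HI\<^sub>o a)"
    "\<eta> b \<cdot> triv e = HI e \<cdot> triv_pr e"
    using C.pullbackD[OF triv_pullback[OF e]] by simp_all
qed

lemma triv_lift_ex1:
  assumes e: "e \<in> hom C a b" and x: "x \<in> hom C z b" and y: "y \<in> hom C z (HI\<^sub>o a)" and "\<eta> b \<cdot> x = HI e \<cdot> y"
  shows "\<exists>!u. u \<in> hom C z (triv_dom e) \<and> triv e \<cdot> u = x \<and> triv_pr e \<cdot> u = y"
proof -
  have "Dom C (\<eta> b) = b" "Dom C (HI e) = HI\<^sub>o a"
    using \<eta>_hom[of b] HI_hom[OF e] C.hom_objs[OF e] by (auto simp: C.in_hom_iff)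
  then show ?thesis
    using C.pullback_lift_ex1[OF triv_pullback[OF e], of x z y] assms by simp
qed

lemmas triv_unique = C.pullback_lift_unique[OF triv_pullback]

lemma triv_unit:
  assumes e: "e \<in> hom C a b"
  shows "triv_unit e \<in> hom C a (triv_dom e)" "triv e \<cdot> triv_unit e = e" "triv_pr e \<cdot> triv_unit e = \<eta> a"
proof -
  have a: "a \<in> Obj C" "Dom C e = a" using C.hom_objs[OF e] e by (auto simp: C.in_hom_iff)
  from theI'[OF triv_lift_ex1[OF e e \<eta>_hom[OF a(1)] \<eta>_natural[OF e]]]
  show "triv_unit e \<in> hom C a (triv_dom e)" "triv e \<cdot> triv_unit e = e" "triv_pr e \<cdot> triv_unit e = \<eta> a"
    by (simp_all add: triv_unit_def a)
qed

lemma E_pullbackD: "\<lbrakk>is_pullback C f g p q; f \<in> \<E>\<rbrakk> \<Longrightarrow> q \<in> \<E>"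
  using E_pullback unfolding pullback_stable_def by blast

lemma triv_in_E:
  assumes "e \<in> \<E>"
  shows "triv e \<in> \<E>"
proof -
  have "HI e \<in> \<E>" using assms H_fib I_fib by auto
  then show ?thesis
    using E_pullbackD[OF C.pullback_swap[OF triv_pullback[OF E_hom[OF assms]]]] by blast
qed

text \<open>This is where admissibility enters. The unit of \<open>triv e\<close> is a morphism between the fibrations
  \<open>H\<^sup>B(I(e))\<close> and \<open>H\<^sup>B(I(triv e))\<close> over \<open>B\<close>, so by fullness it has the form \<open>H\<^sup>B(s)\<close>; comparing
  components in \<open>HI(triv_dom e)\<close> gives \<open>\<eta> = H(s) \<cdot> triv_pr e\<close>. Precomposing with \<open>triv_unit e\<close> and
  transposing identifies \<open>s\<close> as \<open>I(triv_unit e)\<close>.\<close>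
lemma \<eta>_triv_dom:
  assumes eE: "e \<in> \<E>" and e: "e \<in> hom C a b"
  shows "\<eta> (triv_dom e) = HI (triv_unit e) \<cdot> triv_pr e"
proof -
  note T = triv_homs[OF e] and U = triv_unit[OF e] and TT = triv_homs[OF T(1)]
    and TU = triv_unit[OF T(1)]
  have b: "b \<in> Obj C" "Cod C e = b" "Cod C (triv e) = b" and a: "a \<in> Obj C"
    using C.hom_objs[OF e] e T(1) by (auto simp: C.in_hom_iff)
  let ?X = "fib_over X \<F> (FObj I b)" and ?C = "fib_over C \<E> b" and ?H = "H_over C H \<eta> b"
  note Ie = I_hom[OF e] and It = I_hom[OF T(1)]
  have F: "FMor I e \<in> \<F>" "FMor I (triv e) \<in> \<F>"
    using eE triv_in_E[OF eE] I_fib by auto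
  have objs: "FMor I e \<in> Obj ?X" "FMor I (triv e) \<in> Obj ?X"
    using F Ie It by (auto simp: fib_over_def X.in_hom_iff)
  have chosen: "fst (chosen_pullback C (\<eta> b) (HI e)) = triv e" "snd (chosen_pullback C (\<eta> b) (HI e)) = triv_pr e"
    "fst (chosen_pullback C (\<eta> b) (HI (triv e))) = triv (triv e)"
    "snd (chosen_pullback C (\<eta> b) (HI (triv e))) = triv_pr (triv e)"
    by (rule triv_def[of e, unfolded b(2), symmetric] triv_pr_def[of e, unfolded b(2), symmetric]
        triv_def[of "triv e", unfolded b(3), symmetric] triv_pr_def[of "triv e", unfolded b(3), symmetric])+
  have HO: "FObj ?H (FMor I e) = triv e" "FObj ?H (FMor I (triv e)) = triv (triv e)"
    by (simp_all add: H_over_def Let_def chosen)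
  have "(triv e, triv_unit (triv e), triv (triv e)) \<in> hom ?C (triv e) (triv (triv e))"
    using T(1) TT(1) TU(1,2) triv_in_E[OF eE] triv_in_E[OF triv_in_E[OF eE]]
    by (auto simp: fib_over_def hom_def)
  moreover have full: "full ?X ?C ?H"
    using admissible b(1) unfolding admissible_def by blast
  ultimately obtain t where t: "t \<in> hom ?X (FMor I e) (FMor I (triv e))"
    and Ht: "FMor ?H t = (triv e, triv_unit (triv e), triv (triv e))"
    using full objs unfolding full_def by (metis HO)
  obtain s where ts: "t = (FMor I e, s, FMor I (triv e))"
    using t by (cases t) (auto simp: hom_def fib_over_def)
  have s: "s \<in> hom X (FObj I a) (FObj I (triv_dom e))" "FMor I (triv e) \<cdot>\<^bsub>X\<^esub> s = FMor I e"
    using t Ie It unfolding ts by (auto simp: hom_def fib_over_def)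
  have "\<eta> b \<cdot> triv e = HI (triv e) \<cdot> (FMor H s \<cdot> triv_pr e)"
    using T(3) C.assoc[OF T(2) H_hom[OF s(1)] H_hom[OF It]] H_comp[OF s(1) It] s(2) by simp
  from theI'[OF triv_lift_ex1[OF T(1) T(1) C.comp_hom[OF T(2) H_hom[OF s(1)]] this]]
  have "triv_pr (triv e) \<cdot> triv_unit (triv e) = FMor H s \<cdot> triv_pr e"
    using Ht unfolding ts
    by (simp add: H_over_def Let_def chosen)
  then have eq: "\<eta> (triv_dom e) = FMor H s \<cdot> triv_pr e"
    using TU(3) by simp
  have "FMor H s \<cdot> \<eta> a = HI (triv_unit e) \<cdot> \<eta> a"
    using C.assoc[OF U(1) T(2) H_hom[OF s(1)]] U(3) eq \<eta>_natural[OF U(1)] by simp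
  then have "s = FMor I (triv_unit e)"
    using transpose_unique[OF s(1) I_hom[OF U(1)] a] by simp
  with eq show ?thesis by simp
qed

text \<open>By \<open>\<eta>_triv_dom\<close>, the transpose \<open>s\<close> of \<open>triv_pr e\<close> satisfies \<open>I(triv_unit e) \<cdot> s = 1\<close>.
  Composition with \<open>H(s)\<close> turns a pair compatible with the naturality square of \<open>\<eta>\<close> at \<open>triv e\<close>
  into one compatible with the defining pullback of \<open>triv e\<close>; the map that the latter induces
  has the right component in \<open>HI(triv_dom e)\<close> because of this equation.\<close>
lemma trivial_extension_triv:
  assumes eE: "e \<in> \<E>"
  shows "trivial_extension C I H \<eta> \<E> (triv e)"
proof -
  obtain a b where e: "e \<in> hom C a b" using E_hom[OF eE] by blast
  note T = triv_homs[OF e] and U = triv_unit[OF e] and k = \<eta>_triv_dom[OF eE e]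
  have b: "b \<in> Obj C" "Cod C (triv e) = b" and a: "a \<in> Obj C" and d: "triv_dom e \<in> Obj C"
    using C.hom_objs[OF e] T(1) C.hom_objs[OF T(1)] by (auto simp: C.in_hom_iff)
  obtain s where s: "s \<in> hom X (FObj I (triv_dom e)) (FObj I a)" "FMor H s \<cdot> \<eta> (triv_dom e) = triv_pr e"
    by (rule bexE[OF transpose_exists[OF T(2) I.FObj_in[OF a]]])
  note Hs = H_hom[OF s(1)] and HU = HI_hom[OF U(1)] and Ht = HI_hom[OF T(1)] and Hd = \<eta>_hom[OF d]
    and Hb = \<eta>_hom[OF b(1)] and He = HI_hom[OF e]
  have "FMor I e \<cdot>\<^bsub>X\<^esub> s = FMor I (triv e)"
  proof (rule transpose_unique[OF X.comp_hom[OF s(1) I_hom[OF e]] I_hom[OF T(1)] d])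
    show "FMor H (FMor I e \<cdot>\<^bsub>X\<^esub> s) \<cdot> \<eta> (triv_dom e) = HI (triv e) \<cdot> \<eta> (triv_dom e)"
      by (simp only: H_comp[OF s(1) I_hom[OF e]] C.assoc[OF Hd Hs He] s(2) T(3)[symmetric]
          \<eta>_natural[OF T(1)])
  qed
  then have es: "HI e \<cdot> FMor H s = HI (triv e)"
    using H_comp[OF s(1) I_hom[OF e]] by simp
  have "FMor I (triv_unit e) \<cdot>\<^bsub>X\<^esub> s = Ident X (FObj I (triv_dom e))"
  proof (rule transpose_unique[OF X.comp_hom[OF s(1) I_hom[OF U(1)]] X.ident_hom d])
    show "FObj I (triv_dom e) \<in> Obj X" using d by (rule I.FObj_in)
    then show "FMor H (FMor I (triv_unit e) \<cdot>\<^bsub>X\<^esub> s) \<cdot> \<eta> (triv_dom e)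
      = FMor H (Ident X (FObj I (triv_dom e))) \<cdot> \<eta> (triv_dom e)"
      by (simp only: H_comp[OF s(1) I_hom[OF U(1)]] C.assoc[OF Hd Hs HU] s(2) k[symmetric]
          H.FMor_Ident C.ident_left[OF Hd])
  qed
  then have us: "HI (triv_unit e) \<cdot> FMor H s = Ident C (HI\<^sub>o (triv_dom e))"
    using H_comp[OF s(1) I_hom[OF U(1)]] d by (simp add: H.FMor_Ident I.FObj_in)
  have "is_pullback C (HI (triv e)) (\<eta> b) (\<eta> (triv_dom e)) (triv e)"
  proof (rule C.pullbackI[OF Ht Hb Hd T(1) \<eta>_natural[OF T(1), symmetric]])
    fix z x y assume x: "x \<in> hom C z (HI\<^sub>o (triv_dom e))" and y: "y \<in> hom C z b"
      and xy: "HI (triv e) \<cdot> x = \<eta> b \<cdot> y"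
    have "\<eta> b \<cdot> y = HI e \<cdot> (FMor H s \<cdot> x)"
      by (simp only: C.triangle_comp[OF es x Hs He] xy)
    then obtain u where u: "u \<in> hom C z (triv_dom e)" "triv e \<cdot> u = y" "triv_pr e \<cdot> u = FMor H s \<cdot> x"
      using triv_lift_ex1[OF e y C.comp_hom[OF x Hs]] by blast
    have "\<eta> (triv_dom e) \<cdot> u = x"
      by (simp only: C.triangle_comp[OF k[symmetric] u(1) T(2) HU, symmetric] u(3)
          C.triangle_comp[OF us x Hs HU] C.ident_left[OF x])
    then show "\<exists>u. u \<in> hom C z (triv_dom e) \<and> \<eta> (triv_dom e) \<cdot> u = x \<and> triv e \<cdot> u = y"
      using u by blast
  next
    fix z u v assume u: "u \<in> hom C z (triv_dom e)" and v: "v \<in> hom C z (triv_dom e)"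
      and eq: "\<eta> (triv_dom e) \<cdot> u = \<eta> (triv_dom e) \<cdot> v" "triv e \<cdot> u = triv e \<cdot> v"
    have "triv_pr e \<cdot> u = triv_pr e \<cdot> v"
      using C.triangle_comp[OF s(2) u Hd Hs] C.triangle_comp[OF s(2) v Hd Hs] eq(1) by simp
    then show "u = v"
      using triv_unique[OF e u v eq(2)] by simp
  qed
  then show ?thesis
    using triv_in_E[OF eE] by (simp add: trivial_extension_def b)
qed

lemma trivial_extensionD:
  assumes "trivial_extension C I H \<eta> \<E> t" "t \<in> hom C d b"
  shows "is_pullback C (HI t) (\<eta> b) (\<eta> d) t" "t \<in> \<E>"
  using assms by (auto simp: trivial_extension_def C.in_hom_iff)

text \<open>A map into the trivial extension \<open>t : d \<rightarrow> c\<close> is a pair of compatible maps into \<open>HI(d)\<close> and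
  \<open>c\<close>. For \<open>u\<close> the second component is prescribed, and \<open>\<eta>_triv_dom\<close> forces the first one to
  be \<open>HI(m) \<cdot> triv_pr e\<close>.\<close>
lemma triv_universal:
  assumes eE: "e \<in> \<E>" and e: "e \<in> hom C a b" and triv: "trivial_extension C I H \<eta> \<E> t"
    and t: "t \<in> hom C d c" and h: "h \<in> hom C b c" and m: "m \<in> hom C a d" and sq: "t \<cdot> m = h \<cdot> e"
  shows "\<exists>!u. u \<in> hom C (triv_dom e) d \<and> t \<cdot> u = h \<cdot> triv e \<and> u \<cdot> triv_unit e = m"
proof -
  note T = triv_homs[OF e] and U = triv_unit[OF e] and k = \<eta>_triv_dom[OF eE e]
  note pb = trivial_extensionD(1)[OF triv t]
  have obs: "a \<in> Obj C" "b \<in> Obj C" "c \<in> Obj C" "d \<in> Obj C"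
    using C.hom_objs[OF e] C.hom_objs[OF t] by auto
  note eta = \<eta>_hom[OF obs(1)] \<eta>_hom[OF obs(2)] \<eta>_hom[OF obs(3)] \<eta>_hom[OF obs(4)]
  note HIs = HI_hom[OF e] HI_hom[OF t] HI_hom[OF h] HI_hom[OF m]
  note ty = e[unfolded C.in_hom_iff] t[unfolded C.in_hom_iff] h[unfolded C.in_hom_iff] m[unfolded C.in_hom_iff]
    T(1,2)[unfolded C.in_hom_iff] U(1)[unfolded C.in_hom_iff] eta[unfolded C.in_hom_iff]
    HIs[unfolded C.in_hom_iff]
  have "HI t \<cdot> HI m = HI h \<cdot> HI e"
    using HI_comp[OF m t] HI_comp[OF e h] sq by simp
  then have "HI t \<cdot> (HI m \<cdot> triv_pr e) = HI h \<cdot> (HI e \<cdot> triv_pr e)"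
    by (rule C.square_comp[OF _ T(2) HIs(4,2,1,3)])
  also have "\<dots> = \<eta> c \<cdot> (h \<cdot> triv e)"
    using C.square_comp[OF \<eta>_natural[OF h] T(1) h eta(3,2) HIs(3)] T(3) by simp
  finally obtain u where u: "u \<in> hom C (triv_dom e) d" "\<eta> d \<cdot> u = HI m \<cdot> triv_pr e" "t \<cdot> u = h \<cdot> triv e"
    using C.pullback_lift[OF pb, of "HI m \<cdot> triv_pr e" "triv_dom e" "h \<cdot> triv e"]
      C.comp_hom[OF T(2) HIs(4)] C.comp_hom[OF T(1) h] ty by auto
  have "u \<cdot> triv_unit e = m"
  proof (rule C.pullback_lift_unique[OF pb])
    show "u \<cdot> triv_unit e \<in> hom C a (Dom C (\<eta> d))" "m \<in> hom C a (Dom C (\<eta> d))"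
      using C.comp_hom[OF U(1) u(1)] m ty by simp_all
    show "\<eta> d \<cdot> u \<cdot> triv_unit e = \<eta> d \<cdot> m"
      using C.square_comp[OF u(2) U(1) u(1) eta(4) T(2) HIs(4)] U(3) \<eta>_natural[OF m] by simp
    show "t \<cdot> u \<cdot> triv_unit e = t \<cdot> m"
      using C.square_comp[OF u(3) U(1) u(1) t T(1) h] U(2) sq by simp
  qed
  moreover have "v = w" if v: "v \<in> hom C (triv_dom e) d" "t \<cdot> v = h \<cdot> triv e" "v \<cdot> triv_unit e = m"
    and w: "w \<in> hom C (triv_dom e) d" "t \<cdot> w = h \<cdot> triv e" "w \<cdot> triv_unit e = m" for v w
  proof (rule C.pullback_lift_unique[OF pb])
    have "\<eta> d \<cdot> r = HI m \<cdot> triv_pr e" if r: "r \<in> hom C (triv_dom e) d" "r \<cdot> triv_unit e = m" for r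
      using \<eta>_natural[OF r(1)] k HI_comp[OF U(1) r(1)] r(2)
        C.assoc[OF T(2) HI_hom[OF U(1)] HI_hom[OF r(1)]] by simp
    then show "\<eta> d \<cdot> v = \<eta> d \<cdot> w" using v w by simp
    show "v \<in> hom C (triv_dom e) (Dom C (\<eta> d))" "w \<in> hom C (triv_dom e) (Dom C (\<eta> d))" "t \<cdot> v = t \<cdot> w"
      using v w ty by simp_all
  qed
  ultimately show ?thesis using u(1,3) by blast
qed

lemma triv_endo_identity:
  assumes eE: "e \<in> \<E>" and e: "e \<in> hom C a b" and x: "x \<in> hom C (triv_dom e) (triv_dom e)"
    and tx: "triv e \<cdot> x = triv e" and xu: "x \<cdot> triv_unit e = triv_unit e"
  shows "x = Ident C (triv_dom e)"
proof -
  note T = triv_homs[OF e] and U = triv_unit[OF e]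
  have b: "b \<in> Obj C" and d: "triv_dom e \<in> Obj C"
    using C.hom_objs[OF T(1)] by auto
  have ex1: "\<exists>!v. v \<in> hom C (triv_dom e) (triv_dom e) \<and> triv e \<cdot> v = Ident C b \<cdot> triv e \<and>
      v \<cdot> triv_unit e = triv_unit e"
    by (rule triv_universal[OF eE e trivial_extension_triv[OF eE] T(1) C.ident_hom[OF b] U(1)])
      (simp only: U(2) C.ident_left[OF e])
  show ?thesis
    by (rule ex1_unique[OF ex1], (intro conjI x xu C.ident_hom[OF d] C.ident_left[OF U(1)];
        (simp only: tx C.ident_left[OF T(1)] C.ident_right[OF T(1)])?)+)
qed

lemma trivial_if_triv_unit_iso:
  assumes eE: "e \<in> \<E>" and e: "e \<in> hom C a b" and r: "r \<in> hom C (triv_dom e) a"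
    and ru: "r \<cdot> triv_unit e = Ident C a" and ur: "triv_unit e \<cdot> r = Ident C (triv_dom e)"
  shows "trivial_extension C I H \<eta> \<E> e"
proof -
  note T = triv_homs[OF e] and U = triv_unit[OF e]
  have obs: "a \<in> Obj C" "b \<in> Obj C" using C.hom_objs[OF e] by auto
  have er: "e \<cdot> r = triv e"
    using C.triangle_comp[OF U(2) r U(1) T(1)] ur C.ident_right[OF T(1)] by simp
  have \<eta>r: "\<eta> a \<cdot> r = triv_pr e"
    using C.triangle_comp[OF U(3) r U(1) T(2)] ur C.ident_right[OF T(2)] by simp
  have "is_pullback C (HI e) (\<eta> b) (\<eta> a) e"
  proof (rule C.pullbackI[OF HI_hom[OF e] \<eta>_hom[OF obs(2)] \<eta>_hom[OF obs(1)] e \<eta>_natural[OF e, symmetric]])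
    fix z x y assume x: "x \<in> hom C z (HI\<^sub>o a)" and y: "y \<in> hom C z b" and xy: "HI e \<cdot> x = \<eta> b \<cdot> y"
    obtain u where u: "u \<in> hom C z (triv_dom e)" "triv e \<cdot> u = y" "triv_pr e \<cdot> u = x"
      using triv_lift_ex1[OF e y x xy[symmetric]] by blast
    then show "\<exists>u. u \<in> hom C z a \<and> \<eta> a \<cdot> u = x \<and> e \<cdot> u = y"
      using C.triangle_comp[OF er u(1) r e] C.triangle_comp[OF \<eta>r u(1) r \<eta>_hom[OF obs(1)]]
        C.comp_hom[OF u(1) r] by auto
  next
    fix z u v assume u: "u \<in> hom C z a" and v: "v \<in> hom C z a"
      and eq: "\<eta> a \<cdot> u = \<eta> a \<cdot> v" "e \<cdot> u = e \<cdot> v"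
    have "triv_unit e \<cdot> u = triv_unit e \<cdot> v"
    proof (rule triv_unique[OF e C.comp_hom[OF u U(1)] C.comp_hom[OF v U(1)]])
      show "triv e \<cdot> triv_unit e \<cdot> u = triv e \<cdot> triv_unit e \<cdot> v"
        using C.triangle_comp[OF U(2) u U(1) T(1)] C.triangle_comp[OF U(2) v U(1) T(1)] eq by simp
      show "triv_pr e \<cdot> triv_unit e \<cdot> u = triv_pr e \<cdot> triv_unit e \<cdot> v"
        using C.triangle_comp[OF U(3) u U(1) T(2)] C.triangle_comp[OF U(3) v U(1) T(2)] eq by simp
    qed
    then show "u = v"
      by (metis C.triangle_comp[OF ru u U(1) r] C.triangle_comp[OF ru v U(1) r]
          C.ident_left[OF u] C.ident_left[OF v])
  qed
  then show ?thesis
    using eE e by (simp add: trivial_extension_def C.in_hom_iff)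
qed

text \<open>The universal property of \<open>triv t'\<close>, applied to the trivial extension \<open>t\<close>, gives a map from
  \<open>triv t'\<close> to \<open>t\<close>, hence to the pullback \<open>t'\<close>. It is inverse to the unit of \<open>t'\<close>.\<close>
lemma trivial_extension_pullback:
  assumes triv: "trivial_extension C I H \<eta> \<E> t" and pb: "is_pullback C t h m t'"
  shows "trivial_extension C I H \<eta> \<E> t'"
proof -
  define a b c d where "a = Dom C m" and "b = Dom C h" and "c = Cod C t" and "d = Dom C t"
  note P = C.pullbackD[OF pb, folded a_def b_def c_def d_def]
  have t'E: "t' \<in> \<E>"
    using E_pullbackD[OF pb] triv by (simp add: trivial_extension_def)
  note T = triv_homs[OF P(4)] and U = triv_unit[OF P(4)]
  obtain u where u: "u \<in> hom C (triv_dom t') d" "t \<cdot> u = h \<cdot> triv t'" "u \<cdot> triv_unit t' = m"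
    using triv_universal[OF t'E P(4) triv P(1,2,3,5)] by blast
  obtain r where r: "r \<in> hom C (triv_dom t') a" "m \<cdot> r = u" "t' \<cdot> r = triv t'"
    using C.pullback_lift[OF pb, folded a_def b_def d_def, OF u(1) T(1) u(2)] by blast
  have obs: "a \<in> Obj C" "b \<in> Obj C" "triv_dom t' \<in> Obj C"
    using C.hom_objs[OF P(4)] C.hom_objs[OF T(1)] by auto
  have ru: "r \<cdot> triv_unit t' = Ident C a"
  proof (rule C.pullback_lift_unique[OF pb, folded a_def, OF C.comp_hom[OF U(1) r(1)] C.ident_hom[OF obs(1)]])
    show "m \<cdot> r \<cdot> triv_unit t' = m \<cdot> Ident C a"
      using C.triangle_comp[OF r(2) U(1) r(1) P(3)] u(3) C.ident_right[OF P(3)] by simp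
    show "t' \<cdot> r \<cdot> triv_unit t' = t' \<cdot> Ident C a"
      using C.triangle_comp[OF r(3) U(1) r(1) P(4)] U(2) C.ident_right[OF P(4)] by simp
  qed
  have "triv_unit t' \<cdot> r = Ident C (triv_dom t')"
  proof (rule triv_endo_identity[OF t'E P(4) C.comp_hom[OF r(1) U(1)]])
    show "triv t' \<cdot> (triv_unit t' \<cdot> r) = triv t'"
      by (simp only: C.triangle_comp[OF U(2) r(1) U(1) T(1)] r(3))
    show "(triv_unit t' \<cdot> r) \<cdot> triv_unit t' = triv_unit t'"
      by (simp only: C.assoc[OF U(1) r(1) U(1)] ru C.ident_right[OF U(1)])
  qed
  then show ?thesis
    by (rule trivial_if_triv_unit_iso[OF t'E P(4) r(1) ru])
qed

end

section \<open>Trivial and normal extensions\<close>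

context admissible_galois_structure
begin

lemma trivial_imp_normal:
  assumes "trivial_extension C I H \<eta> \<E> t"
  shows "normal_extension C I H \<eta> \<E> t"
  using assms trivial_extension_pullback[OF assms] C.pullback_swap
  unfolding normal_extension_def is_kernel_pair_def trivial_extension_def[of C I H \<eta> \<E> t] by blast

text \<open>Pulling \<open>n\<close> back along \<open>n \<cdot> v\<close> amounts to pulling the kernel pair projection \<open>q\<close> of
  \<open>n\<close> back along \<open>v\<close>, and \<open>q\<close> is trivial because \<open>n\<close> is normal.\<close>
lemma normal_pullback_along_lift_trivial:
  assumes n: "normal_extension C I H \<eta> \<E> n" and v: "v \<in> hom C b (Dom C n)"
    and pb: "is_pullback C n (n \<cdot> v) x y"
  shows "trivial_extension C I H \<eta> \<E> y"
proof -
  define d c where "d = Dom C n" and "c = Cod C n"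
  have nh: "n \<in> hom C d c"
    using n E_Mor by (auto simp: normal_extension_def C.in_hom_iff d_def c_def)
  have v: "v \<in> hom C b d" using v by (simp add: d_def)
  have b: "Dom C (n \<cdot> v) = b" using C.comp_hom[OF v nh] by (simp add: C.in_hom_iff)
  define P where "P = Dom C x"
  have x: "x \<in> hom C P d" and y: "y \<in> hom C P b" and xy: "n \<cdot> x = n \<cdot> (v \<cdot> y)"
    using C.pullbackD[OF pb] C.assoc[OF _ v nh] by (simp_all add: P_def b d_def)
  obtain p q where kp: "is_pullback C n n p q"
    using C.pullback_exists[OF nh nh] by blast
  have triv: "trivial_extension C I H \<eta> \<E> q"
    using n kp by (auto simp: normal_extension_def is_kernel_pair_def)
  define K where "K = Dom C p"
  have p: "p \<in> hom C K d" and q: "q \<in> hom C K d" and pq: "n \<cdot> p = n \<cdot> q"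
    using C.pullbackD[OF kp] by (simp_all add: K_def d_def)
  obtain w where w: "w \<in> hom C P K" "p \<cdot> w = x" "q \<cdot> w = v \<cdot> y"
    using C.pullback_lift[OF kp, folded K_def d_def, OF x C.comp_hom[OF y v] xy] by blast
  have "is_pullback C q v w y"
  proof (rule C.pullbackI[OF q v w(1) y w(3)])
    fix z s r assume s: "s \<in> hom C z K" and r: "r \<in> hom C z b" and sr: "q \<cdot> s = v \<cdot> r"
    have "n \<cdot> (p \<cdot> s) = (n \<cdot> v) \<cdot> r"
      using C.square_comp[OF pq s p nh q nh] sr C.assoc[OF r v nh] by simp
    then obtain u where u: "u \<in> hom C z P" "x \<cdot> u = p \<cdot> s" "y \<cdot> u = r"
      using C.pullback_lift[OF pb, folded P_def d_def, unfolded b, OF C.comp_hom[OF s p] r] by blast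
    have "w \<cdot> u = s"
    proof (rule C.pullback_lift_unique[OF kp, folded K_def, OF C.comp_hom[OF u(1) w(1)] s])
      show "p \<cdot> w \<cdot> u = p \<cdot> s"
        using C.triangle_comp[OF w(2) u(1) w(1) p] u(2) by simp
      show "q \<cdot> w \<cdot> u = q \<cdot> s"
        using C.square_comp[OF w(3) u(1) w(1) q y v] u(3) sr by simp
    qed
    with u show "\<exists>u. u \<in> hom C z P \<and> w \<cdot> u = s \<and> y \<cdot> u = r" by blast
  next
    fix z s r assume s: "s \<in> hom C z P" and r: "r \<in> hom C z P" and eq: "w \<cdot> s = w \<cdot> r" "y \<cdot> s = y \<cdot> r"
    have "x \<cdot> s = x \<cdot> r"
      using C.triangle_comp[OF w(2) s w(1) p] C.triangle_comp[OF w(2) r w(1) p] eq by simp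
    then show "s = r"
      using C.pullback_lift_unique[OF pb, folded P_def, OF s r] eq by simp
  qed
  then show ?thesis by (rule trivial_extension_pullback[OF triv])
qed

text \<open>A map into \<open>n\<close> over \<open>n \<cdot> v\<close> is a map into the pullback of \<open>n\<close> along \<open>n \<cdot> v\<close>, which
  is a trivial extension.\<close>
lemma triv_universal_normal:
  assumes eE: "e \<in> \<E>" and e: "e \<in> hom C a b" and norm: "normal_extension C I H \<eta> \<E> n"
    and n: "n \<in> hom C d c" and v: "v \<in> hom C b d" and m: "m \<in> hom C a d" and sq: "n \<cdot> m = (n \<cdot> v) \<cdot> e"
  shows "\<exists>!u. u \<in> hom C (triv_dom e) d \<and> n \<cdot> u = (n \<cdot> v) \<cdot> triv e \<and> u \<cdot> triv_unit e = m"
proof -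
  note T = triv_homs[OF e] and U = triv_unit[OF e]
  have dom: "Dom C n = d" "Dom C (n \<cdot> v) = b" using n C.comp_hom[OF v n] by (auto simp: C.in_hom_iff)
  obtain x y where pb: "is_pullback C n (n \<cdot> v) x y"
    using C.pullback_exists[OF n C.comp_hom[OF v n]] by blast
  have triv: "trivial_extension C I H \<eta> \<E> y"
    by (rule normal_pullback_along_lift_trivial[OF norm v[folded dom(1)] pb])
  define P where "P = Dom C x"
  note nv = C.comp_hom[OF v n]
  have x: "x \<in> hom C P d" and y: "y \<in> hom C P b" and xy: "n \<cdot> x = (n \<cdot> v) \<cdot> y"
    using C.pullbackD[OF pb] by (simp_all add: P_def dom)
  have b: "b \<in> Obj C" using C.hom_objs[OF v] by simp
  note lift = C.pullback_lift_ex1[OF pb, folded P_def, unfolded dom]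
    and uniq = C.pullback_lift_unique[OF pb, folded P_def]
  obtain m' where m': "m' \<in> hom C a P" "x \<cdot> m' = m" "y \<cdot> m' = e"
    using lift[OF m e sq] by blast
  have "y \<cdot> m' = Ident C b \<cdot> e" using m'(3) C.ident_left[OF e] by simp
  from triv_universal[OF eE e triv y C.ident_hom[OF b] m'(1) this]
  have ex1: "\<exists>!u. u \<in> hom C (triv_dom e) P \<and> y \<cdot> u = triv e \<and> u \<cdot> triv_unit e = m'"
    by (simp add: C.ident_left[OF T(1)])
  then obtain u where u: "u \<in> hom C (triv_dom e) P" "y \<cdot> u = triv e" "u \<cdot> triv_unit e = m'" by blast
  have "x \<cdot> u \<in> hom C (triv_dom e) d" "n \<cdot> (x \<cdot> u) = (n \<cdot> v) \<cdot> triv e" "(x \<cdot> u) \<cdot> triv_unit e = m"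
    using C.comp_hom[OF u(1) x] C.square_comp[OF xy u(1) x n y nv] C.assoc[OF U(1) u(1) x] u m' by simp_all
  moreover have "r = x \<cdot> u"
    if r: "r \<in> hom C (triv_dom e) d" "n \<cdot> r = (n \<cdot> v) \<cdot> triv e" "r \<cdot> triv_unit e = m" for r
  proof -
    obtain r' where r': "r' \<in> hom C (triv_dom e) P" "x \<cdot> r' = r" "y \<cdot> r' = triv e"
      using lift[OF r(1) T(1) r(2)] by blast
    have "r' \<cdot> triv_unit e = m'"
      by (rule uniq[OF C.comp_hom[OF U(1) r'(1)] m'(1)])
        (simp_all add: C.triangle_comp[OF r'(2) U(1) r'(1) x] C.triangle_comp[OF r'(3) U(1) r'(1) y] r(3) m' U(2))
    then have "r' = u" 
      by - (rule ex1_unique[OF ex1], (intro conjI r' u; assumption?)+)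
    then show ?thesis using r' by simp
  qed
  ultimately show ?thesis by blast
qed

end

section \<open>The reflection of fibrations into normal extensions\<close>

locale normal_descent = admissible_galois_structure C X I H \<eta> \<epsilon> \<E> \<F>
  for C :: "('o, 'm) cat" (structure) and X :: "('p, 'n) cat" and I H \<eta> \<epsilon> \<E> \<F> +
  assumes E_regular_epi: "\<E> = {e. regular_epi C e}"
    and reflexive_coequalisers: "has_reflexive_coequalisers C"
    and descent: "\<lbrakk> regular_epi C h;
        is_kernel_pair C h p\<^sub>1 p\<^sub>2; reflexive_graph C p\<^sub>1 p\<^sub>2 \<delta>;
        reflexive_graph C d c s;
        f'' \<in> \<E>; f' \<in> \<E>;
        reflexive_graph (Fib C \<E>) (f'', (d, p\<^sub>1), f') (f'', (c, p\<^sub>2), f') (f', (s, \<delta>), f'');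
        is_coequaliser C d c g;
        is_coequaliser (arrow_cat C) (f'', (d, p\<^sub>1), f') (f'', (c, p\<^sub>2), f') (f', (g, h), f);
        normal_extension C I H \<eta> \<E> f'; normal_extension C I H \<eta> \<E> f'' \<rbrakk>
      \<Longrightarrow> normal_extension C I H \<eta> \<E> f"

context normal_descent
begin

text \<open>The squares \<open>(v, \<beta>)\<close> range over all maps from \<open>f\<close> to normal extensions, with any codomain.
  Taking \<open>\<beta>\<close> to be an identity gives the universal property over a fixed base.\<close>
lemma normal_reflection:
  assumes fE: "f \<in> \<E>"
  obtains n k where "normal_extension C I H \<eta> \<E> n" "Cod C n = Cod C f"
    and "k \<in> hom C (Dom C f) (Dom C n)" "n \<cdot> k = f"
    and "\<And>m v \<beta>. \<lbrakk>normal_extension C I H \<eta> \<E> m; v \<in> hom C (Dom C f) (Dom C m);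
        \<beta> \<in> hom C (Cod C f) (Cod C m); m \<cdot> v = \<beta> \<cdot> f\<rbrakk>
      \<Longrightarrow> \<exists>!u. u \<in> hom C (Dom C n) (Dom C m) \<and> m \<cdot> u = \<beta> \<cdot> n \<and> u \<cdot> k = v"
proof -
  define A B where "A = Dom C f" and "B = Cod C f"
  have f: "f \<in> hom C A B" and reg: "regular_epi C f"
    using E_hom[OF fE] fE by (auto simp: A_def B_def E_regular_epi)
  obtain p\<^sub>1 p\<^sub>2 where pb: "is_pullback C f f p\<^sub>1 p\<^sub>2"
    using C.pullback_exists[OF f f] by blast
  define K where "K = Dom C p\<^sub>1"
  have kp: "is_kernel_pair C f p\<^sub>1 p\<^sub>2" using pb by (simp add: is_kernel_pair_def)
  have p: "p\<^sub>1 \<in> hom C K A" "p\<^sub>2 \<in> hom C K A" and fp: "f \<cdot> p\<^sub>1 = f \<cdot> p\<^sub>2"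
    using C.pullbackD[OF pb] by (simp_all add: K_def A_def)
  obtain S \<delta> \<sigma>\<^sub>1 \<sigma>\<^sub>2 \<rho> \<sigma> \<zeta> where
    \<delta>: "\<delta> \<in> hom C A K" "p\<^sub>1 \<cdot> \<delta> = Ident C A" "p\<^sub>2 \<cdot> \<delta> = Ident C A"
    and s: "\<sigma>\<^sub>1 \<in> hom C S K" "\<sigma>\<^sub>2 \<in> hom C S K" "\<rho> \<in> hom C S K" "\<sigma> \<in> hom C K S" "\<zeta> \<in> hom C K S"
    and ps: "p\<^sub>1 \<cdot> \<sigma>\<^sub>1 = p\<^sub>1 \<cdot> \<rho>" "p\<^sub>1 \<cdot> \<sigma>\<^sub>2 = p\<^sub>2 \<cdot> \<rho>" "p\<^sub>2 \<cdot> \<sigma>\<^sub>1 = p\<^sub>2 \<cdot> \<sigma>\<^sub>2"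
    and pb': "is_pullback C p\<^sub>1 p\<^sub>1 \<sigma>\<^sub>1 \<rho>"
    and \<sigma>: "\<sigma>\<^sub>1 \<cdot> \<sigma> = Ident C K" "\<sigma>\<^sub>2 \<cdot> \<sigma> = Ident C K" "\<rho> \<cdot> \<sigma> = \<delta> \<cdot> p\<^sub>1"
    and \<zeta>: "\<sigma>\<^sub>1 \<cdot> \<zeta> = Ident C K" "\<sigma>\<^sub>2 \<cdot> \<zeta> = \<delta> \<cdot> p\<^sub>2"
    by (rule C.kernel_pair_graph[OF f kp K_def[symmetric]])
  have pE: "p\<^sub>1 \<in> \<E>" by (rule E_pullbackD[OF C.pullback_swap[OF pb] fE])
  have \<rho>E: "\<rho> \<in> \<E>" by (rule E_pullbackD[OF pb' pE])
  define f' f'' i j where "f' = triv p\<^sub>1" and "f'' = triv \<rho>" and "i = triv_unit p\<^sub>1" and "j = triv_unit \<rho>"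
  define A' R where "A' = Dom C f'" and "R = Dom C f''"
  note folds = f'_def[symmetric] f''_def[symmetric] i_def[symmetric] j_def[symmetric]
    A'_def[symmetric] R_def[symmetric]
  note f' = triv_homs(1)[OF p(1), unfolded folds] and f'' = triv_homs(1)[OF s(3), unfolded folds]
    and i = triv_unit(1,2)[OF p(1), unfolded folds] and j = triv_unit(1,2)[OF s(3), unfolded folds]
    and f'_triv = trivial_extension_triv[OF pE, unfolded folds]
    and f''_triv = trivial_extension_triv[OF \<rho>E, unfolded folds]
  note univ' = triv_universal[OF pE p(1), unfolded folds] and univ'' = triv_universal[OF \<rho>E s(3), unfolded folds]
    and endo = triv_endo_identity[OF pE p(1), unfolded folds]
  \<comment> \<open>\<open>d\<close>, \<open>c\<close> and \<open>t\<close> are the images of the squares \<open>(\<sigma>\<^sub>1, p\<^sub>1)\<close>, \<open>(\<sigma>\<^sub>2, p\<^sub>2)\<close> and \<open>(\<sigma>, \<delta>)\<close>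
     under the reflection into trivial extensions.\<close>
  have "f' \<cdot> (i \<cdot> \<sigma>\<^sub>1) = p\<^sub>1 \<cdot> \<rho>" "f' \<cdot> (i \<cdot> \<sigma>\<^sub>2) = p\<^sub>2 \<cdot> \<rho>"
    by (simp_all only: C.triangle_comp[OF i(2) s(1) i(1) f'] C.triangle_comp[OF i(2) s(2) i(1) f'] ps)
  then obtain d c where d: "d \<in> hom C R A'" "f' \<cdot> d = p\<^sub>1 \<cdot> f''" "d \<cdot> j = i \<cdot> \<sigma>\<^sub>1"
    and c: "c \<in> hom C R A'" "f' \<cdot> c = p\<^sub>2 \<cdot> f''" "c \<cdot> j = i \<cdot> \<sigma>\<^sub>2"
    using univ''[OF f'_triv f' p(1) C.comp_hom[OF s(1) i(1)]] univ''[OF f'_triv f' p(2) C.comp_hom[OF s(2) i(1)]]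
    by metis
  have "f'' \<cdot> (j \<cdot> \<sigma>) = \<delta> \<cdot> p\<^sub>1"
    by (simp only: C.triangle_comp[OF j(2) s(4) j(1) f''] \<sigma>)
  then obtain t where t: "t \<in> hom C A' R" "f'' \<cdot> t = \<delta> \<cdot> f'" "t \<cdot> i = j \<cdot> \<sigma>"
    using univ'[OF f''_triv f'' \<delta>(1) C.comp_hom[OF s(4) j(1)]] by metis
  have "d \<cdot> t = Ident C A'"
  proof (rule endo[OF C.comp_hom[OF t(1) d(1)]])
    show "f' \<cdot> (d \<cdot> t) = f'"
      by (simp only: C.square_comp[OF d(2) t(1) d(1) f' f'' p(1)] t(2)
          C.triangle_comp[OF \<delta>(2) f' \<delta>(1) p(1)] C.ident_left[OF f'])
    show "(d \<cdot> t) \<cdot> i = i"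
      by (simp only: C.assoc[OF i(1) t(1) d(1)] t(3) C.square_comp[OF d(3) s(4) j(1) d(1) s(1) i(1)]
          \<sigma> C.ident_right[OF i(1)])
  qed
  moreover have "c \<cdot> t = Ident C A'"
  proof (rule endo[OF C.comp_hom[OF t(1) c(1)]])
    show "f' \<cdot> (c \<cdot> t) = f'"
      by (simp only: C.square_comp[OF c(2) t(1) c(1) f' f'' p(2)] t(2)
          C.triangle_comp[OF \<delta>(3) f' \<delta>(1) p(2)] C.ident_left[OF f'])
    show "(c \<cdot> t) \<cdot> i = i"
      by (simp only: C.assoc[OF i(1) t(1) c(1)] t(3) C.square_comp[OF c(3) s(4) j(1) c(1) s(2) i(1)]
          \<sigma> C.ident_right[OF i(1)])
  qed
  ultimately have graph: "reflexive_graph C d c t" "reflexive_graph C p\<^sub>1 p\<^sub>2 \<delta>"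
    "reflexive_graph (Fib C \<E>) (f'', (d, p\<^sub>1), f') (f'', (c, p\<^sub>2), f') (f', (t, \<delta>), f'')"
    using d c t p \<delta> f' f'' triv_in_E[OF pE] triv_in_E[OF \<rho>E]
    by (auto simp: reflexive_graph_def parallel_def Fib_def hom_def f'_def f''_def)
  obtain g where g: "is_coequaliser C d c g"
    using reflexive_coequalisers graph(1) unfolding has_reflexive_coequalisers_def by blast
  define Q where "Q = Cod C g"
  have gh: "g \<in> hom C A' Q" and gdc: "g \<cdot> d = g \<cdot> c" and cod_d: "Cod C d = A'"
    using g d(1) by (auto simp: is_coequaliser_def Q_def C.in_hom_iff)
  have ff': "f \<cdot> f' \<in> hom C A' B" by (rule C.comp_hom[OF f' f])
  have "(f \<cdot> f') \<cdot> d = (f \<cdot> f') \<cdot> c"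
    by (simp only: C.assoc[OF d(1) f' f] C.assoc[OF c(1) f' f] d(2) c(2) C.square_comp[OF fp f'' p(1) f p(2) f])
  then obtain n where n: "n \<in> hom C Q B" "n \<cdot> g = f \<cdot> f'"
    using C.coequaliser_factor[OF g, unfolded cod_d, OF ff'] by (metis Q_def)
  have "is_coequaliser (arrow_cat C) (f'', (d, p\<^sub>1), f') (f'', (c, p\<^sub>2), f') (f', (g, f), n)"
    by (rule C.arrow_coequaliser[OF g C.regular_epi_coequaliser_of_kernel_pair[OF reg kp]])
      (use d c p f f' f'' n gh in \<open>auto simp: C.in_hom_iff\<close>)
  with graph have normal: "normal_extension C I H \<eta> \<E> n"
    using descent[OF reg kp graph(2,1) _ _ graph(3) g _ trivial_imp_normal[OF f'_triv] trivial_imp_normal[OF f''_triv]]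
      triv_in_E[OF pE] triv_in_E[OF \<rho>E] by (simp add: f'_def f''_def)
  \<comment> \<open>Since \<open>p\<^sub>2\<close> is a coequaliser of \<open>\<sigma>\<^sub>1\<close> and \<open>\<sigma>\<^sub>2\<close> split by \<open>\<delta>\<close>, the map that
     \<open>g \<cdot> i\<close> induces on \<open>A\<close> is its composite with \<open>\<delta>\<close>.\<close>
  define k where "k = g \<cdot> (i \<cdot> \<delta>)"
  have k: "k \<in> hom C A Q"
    using C.comp_hom[OF C.comp_hom[OF \<delta>(1) i(1)] gh] by (simp add: k_def)
  have "n \<cdot> k = f \<cdot> (p\<^sub>1 \<cdot> \<delta>)"
    unfolding k_def
    by (simp only: C.square_comp[OF n(2) C.comp_hom[OF \<delta>(1) i(1)] gh n(1) f' f] C.triangle_comp[OF i(2) \<delta>(1) i(1) f'])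
  then have nk: "n \<cdot> k = f" by (simp only: \<delta> C.ident_right[OF f])
  have "(g \<cdot> i) \<cdot> \<sigma>\<^sub>1 = (g \<cdot> i) \<cdot> \<sigma>\<^sub>2"
    by (simp only: C.assoc[OF s(1) i(1) gh] C.assoc[OF s(2) i(1) gh] d(3)[symmetric] c(3)[symmetric]
        C.square_comp[OF gdc j(1) d(1) gh c(1) gh])
  from C.square_comp[OF this s(5) s(1) C.comp_hom[OF i(1) gh] s(2) C.comp_hom[OF i(1) gh]]
  have kp2: "k \<cdot> p\<^sub>2 = g \<cdot> i"
    by (simp only: \<zeta> C.ident_right[OF C.comp_hom[OF i(1) gh]] k_def
        C.assoc[OF \<delta>(1) i(1) gh, symmetric] C.assoc[OF p(2) \<delta>(1) C.comp_hom[OF i(1) gh]])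
  have univ: "\<exists>!u. u \<in> hom C Q (Dom C m) \<and> m \<cdot> u = \<beta> \<cdot> n \<and> u \<cdot> k = v"
    if m: "normal_extension C I H \<eta> \<E> m" and v: "v \<in> hom C A (Dom C m)" and \<beta>: "\<beta> \<in> hom C B (Cod C m)"
      and mv: "m \<cdot> v = \<beta> \<cdot> f" for m v \<beta>
  proof -
    define N M where "N = Dom C m" and "M = Cod C m"
    have mh: "m \<in> hom C N M" using m E_hom by (simp add: normal_extension_def N_def M_def)
    have v: "v \<in> hom C A N" and \<beta>: "\<beta> \<in> hom C B M" using v \<beta> by (simp_all add: N_def M_def)
    note mv_hom = C.comp_hom[OF v mh] and vp = C.comp_hom[OF p(1) v] C.comp_hom[OF p(2) v]
    note univ_n' = triv_universal_normal[OF pE p(1) m mh v, unfolded folds]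
      and univ_n'' = triv_universal_normal[OF \<rho>E s(3) m mh vp(1), unfolded folds]
    have mvp: "(m \<cdot> v) \<cdot> p\<^sub>2 = (m \<cdot> v) \<cdot> p\<^sub>1"
      by (simp only: mv C.assoc[OF p(1) f \<beta>] C.assoc[OF p(2) f \<beta>] fp)
    \<comment> \<open>\<open>v \<cdot> p\<^sub>2\<close> is extended along \<open>i\<close>, over the base map \<open>m \<cdot> v = \<beta> \<cdot> f\<close>, which lifts
       through \<open>m\<close>.\<close>
    have "m \<cdot> (v \<cdot> p\<^sub>2) = (m \<cdot> v) \<cdot> p\<^sub>1"
      by (simp only: C.assoc[OF p(2) v mh, symmetric] mvp)
    then have ex1: "\<exists>!w. w \<in> hom C A' N \<and> m \<cdot> w = (m \<cdot> v) \<cdot> f' \<and> w \<cdot> i = v \<cdot> p\<^sub>2"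
      by (rule univ_n'[OF vp(2)])
    then obtain w where w: "w \<in> hom C A' N" "m \<cdot> w = (m \<cdot> v) \<cdot> f'" "w \<cdot> i = v \<cdot> p\<^sub>2" by blast
    \<comment> \<open>Both \<open>w \<cdot> d\<close> and \<open>w \<cdot> c\<close> extend \<open>v \<cdot> p\<^sub>2 \<cdot> \<sigma>\<^sub>1 = v \<cdot> p\<^sub>2 \<cdot> \<sigma>\<^sub>2\<close> along \<open>j\<close>, so they
       are equal by uniqueness of such extensions.\<close>
    have "m \<cdot> ((v \<cdot> p\<^sub>2) \<cdot> \<sigma>\<^sub>1) = (m \<cdot> (v \<cdot> p\<^sub>1)) \<cdot> \<rho>"
      by (simp only: C.assoc[OF s(1) vp(2) mh, symmetric] C.assoc[OF p(2) v mh, symmetric]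
          C.assoc[OF p(1) v mh, symmetric] mvp C.assoc[OF s(1) p(1) mv_hom] C.assoc[OF s(3) p(1) mv_hom] ps)
    then have ex1'': "\<exists>!x. x \<in> hom C R N \<and> m \<cdot> x = (m \<cdot> (v \<cdot> p\<^sub>1)) \<cdot> f'' \<and> x \<cdot> j = (v \<cdot> p\<^sub>2) \<cdot> \<sigma>\<^sub>1"
      by (rule univ_n''[OF C.comp_hom[OF s(1) vp(2)]])
    have "w \<cdot> d = w \<cdot> c"
    proof (rule ex1_unique[OF ex1'']; intro conjI)
      show "w \<cdot> d \<in> hom C R N" "w \<cdot> c \<in> hom C R N"
        by (rule C.comp_hom[OF d(1) w(1)], rule C.comp_hom[OF c(1) w(1)])
      show "m \<cdot> (w \<cdot> d) = (m \<cdot> (v \<cdot> p\<^sub>1)) \<cdot> f''" "m \<cdot> (w \<cdot> c) = (m \<cdot> (v \<cdot> p\<^sub>1)) \<cdot> f''"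
        by (simp_all only: C.square_comp[OF w(2) d(1) w(1) mh f' mv_hom] C.square_comp[OF w(2) c(1) w(1) mh f' mv_hom]
            d(2) c(2) C.assoc[OF p(1) v mh, symmetric] C.square_comp[OF mvp f'' p(2) mv_hom p(1) mv_hom]
            C.assoc[OF f'' p(1) mv_hom])
      show "(w \<cdot> d) \<cdot> j = (v \<cdot> p\<^sub>2) \<cdot> \<sigma>\<^sub>1" "(w \<cdot> c) \<cdot> j = (v \<cdot> p\<^sub>2) \<cdot> \<sigma>\<^sub>1"
        by (simp_all only: C.assoc[OF j(1) d(1) w(1)] C.assoc[OF j(1) c(1) w(1)] d(3) c(3)
            C.square_comp[OF w(3) s(1) i(1) w(1) p(2) v] C.square_comp[OF w(3) s(2) i(1) w(1) p(2) v] ps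
            C.assoc[OF s(1) p(2) v])
    qed
    then obtain u where u: "u \<in> hom C Q N" "u \<cdot> g = w"
      using C.coequaliser_factor[OF g, unfolded cod_d, OF w(1)] by (metis Q_def)
    have gepi: "x = y" if "x \<in> hom C Q z" "y \<in> hom C Q z" "x \<cdot> g = y \<cdot> g" for x y z
      using C.coequaliser_epi[OF g, folded Q_def] that by blast
    have "m \<cdot> u = \<beta> \<cdot> n"
      by (rule gepi[OF C.comp_hom[OF u(1) mh] C.comp_hom[OF n(1) \<beta>]])
        (simp only: C.assoc[OF gh u(1) mh] C.assoc[OF gh n(1) \<beta>] u(2) w(2) n(2) mv C.assoc[OF f' f \<beta>])
    moreover have "u \<cdot> k = v"
      unfolding k_def
      by (simp only: C.triangle_comp[OF u(2) C.comp_hom[OF \<delta>(1) i(1)] gh u(1)]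
          C.square_comp[OF w(3) \<delta>(1) i(1) w(1) p(2) v] \<delta> C.ident_right[OF v])
    moreover have "x = u" if x: "x \<in> hom C Q N" "m \<cdot> x = \<beta> \<cdot> n" "x \<cdot> k = v" for x
    proof (rule gepi[OF x(1) u(1)])
      have "x \<cdot> g = w"
      proof (rule ex1_unique[OF ex1]; intro conjI w C.comp_hom[OF gh x(1)])
        show "m \<cdot> (x \<cdot> g) = (m \<cdot> v) \<cdot> f'"
          by (simp only: C.square_comp[OF x(2) gh x(1) mh n(1) \<beta>] n(2) mv C.assoc[OF f' f \<beta>])
        show "(x \<cdot> g) \<cdot> i = v \<cdot> p\<^sub>2"
          by (simp only: C.assoc[OF i(1) gh x(1)] kp2[symmetric] C.triangle_comp[OF x(3) p(2) k x(1)])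
      qed
      then show "x \<cdot> g = u \<cdot> g" using u(2) by simp
    qed
    ultimately show ?thesis
      using u(1) unfolding N_def by blast
  qed
  have nQB: "Dom C n = Q" "Cod C n = B" using n(1) by (simp_all add: C.in_hom_iff)
  show thesis
    by (rule that[of n k, folded A_def B_def, unfolded nQB, OF normal refl k nk univ])
qed

lemma Norm_over_reflective:
  assumes B: "B \<in> Obj C"
  shows "reflective_subcategory (Norm_over C I H \<eta> \<E> B) (fib_over C \<E> B)"
proof -
  let ?F = "fib_over C \<E> B" and ?N = "{f. normal_extension C I H \<eta> \<E> f}"
  interpret S: category "slice C B" by (rule C.slice_category)
  interpret F: category ?F unfolding fib_over_def by (rule S.full_subcat_category)
  have hom_F: "x \<in> hom ?F f m \<longleftrightarrow> (\<exists>u. x = (f, u, m) \<and> u \<in> hom C (Dom C f) (Dom C m) \<and> m \<cdot> u = f)"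
    if "f \<in> \<E>" "Cod C f = B" "m \<in> \<E>" "Cod C m = B" for x f m
    using that E_Mor by (cases x) (auto simp: fib_over_def hom_def)
  have Comp_F: "(f', a', g') \<cdot>\<^bsub>?F\<^esub> (f, a, g) = (f, a' \<cdot> a, g')" for f' a' g' f a g
    by (simp add: fib_over_def)
  show ?thesis
    unfolding Norm_over_def
  proof (rule F.reflective_subcategory_if_universal_arrows)
    fix f assume "f \<in> Obj ?F"
    then have fE: "f \<in> \<E>" and fB: "Cod C f = B" by (auto simp: fib_over_def)
    have f: "f \<in> hom C (Dom C f) B" using E_hom[OF fE] fB by simp
    show "\<exists>k \<in> Mor ?F. Dom ?F k = f \<and> Cod ?F k \<in> ?N \<and>
      (\<forall>m \<in> ?N. \<forall>t \<in> hom ?F f m. \<exists>!u. u \<in> hom ?F (Cod ?F k) m \<and> u \<cdot>\<^bsub>?F\<^esub> k = t)"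
    proof (rule normal_reflection[OF fE, unfolded fB])
      fix n k assume n: "normal_extension C I H \<eta> \<E> n" "Cod C n = B"
        and k: "k \<in> hom C (Dom C f) (Dom C n)" "n \<cdot> k = f"
        and univ: "\<And>m v \<beta>. \<lbrakk>normal_extension C I H \<eta> \<E> m; v \<in> hom C (Dom C f) (Dom C m);
            \<beta> \<in> hom C B (Cod C m); m \<cdot> v = \<beta> \<cdot> f\<rbrakk>
          \<Longrightarrow> \<exists>!u. u \<in> hom C (Dom C n) (Dom C m) \<and> m \<cdot> u = \<beta> \<cdot> n \<and> u \<cdot> k = v"
      have nE: "n \<in> \<E>" using n by (simp add: normal_extension_def)
      have nh: "n \<in> hom C (Dom C n) B" using E_hom[OF nE] n by simp
      have K: "(f, k, n) \<in> hom ?F f n"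
        by (subst hom_F[OF fE fB nE n(2)]) (use k in blast)
      have cod: "Cod ?F (f, k, n) = n" using K by (simp add: F.in_hom_iff)
      show ?thesis
      proof (intro bexI[of _ "(f, k, n)"] conjI ballI, unfold cod)
        show "(f, k, n) \<in> Mor ?F" "Dom ?F (f, k, n) = f" "n \<in> ?N"
          using K n by (simp_all add: F.in_hom_iff)
        fix m t assume m: "m \<in> ?N" and t: "t \<in> hom ?F f m"
        have mE: "m \<in> \<E>" using m by (simp add: normal_extension_def)
        have mB: "Cod C m = B" using t by (cases t) (auto simp: fib_over_def hom_def)
        obtain v where tv: "t = (f, v, m)" and v: "v \<in> hom C (Dom C f) (Dom C m)" "m \<cdot> v = f"
          using t[unfolded hom_F[OF fE fB mE mB]] by blast
        have "m \<cdot> v = Ident C B \<cdot> f" by (simp only: v(2) C.ident_left[OF f])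
        then have "\<exists>!u. u \<in> hom C (Dom C n) (Dom C m) \<and> m \<cdot> u = Ident C B \<cdot> n \<and> u \<cdot> k = v"
          using univ[of m v "Ident C B"] m v(1) C.ident_hom[OF B] by (simp add: mB)
        then have ex1: "\<exists>!u. u \<in> hom C (Dom C n) (Dom C m) \<and> m \<cdot> u = n \<and> u \<cdot> k = v"
          by (simp only: C.ident_left[OF nh])
        then obtain u where u: "u \<in> hom C (Dom C n) (Dom C m)" "m \<cdot> u = n" "u \<cdot> k = v" by blast
        show "\<exists>!u. u \<in> hom ?F n m \<and> u \<cdot>\<^bsub>?F\<^esub> (f, k, n) = t"
        proof (rule ex1I[of _ "(n, u, m)"])
          show "(n, u, m) \<in> hom ?F n m \<and> (n, u, m) \<cdot>\<^bsub>?F\<^esub> (f, k, n) = t"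
            unfolding hom_F[OF nE n(2) mE mB] Comp_F tv using u by blast
          fix x assume x: "x \<in> hom ?F n m \<and> x \<cdot>\<^bsub>?F\<^esub> (f, k, n) = t"
          then obtain w where w: "x = (n, w, m)" "w \<in> hom C (Dom C n) (Dom C m)" "m \<cdot> w = n"
            unfolding hom_F[OF nE n(2) mE mB] by blast
          have "w \<cdot> k = v" using x by (simp add: w(1) Comp_F tv)
          then have "w = u" by - (rule ex1_unique[OF ex1]; intro conjI w u; assumption)
          then show "x = (n, u, m)" by (simp only: w(1))
        qed
      qed
    qed
  qed
qed

lemma Norm_reflective:
  "reflective_subcategory (Norm C I H \<eta> \<E>) (Fib C \<E>)"
proof -
  let ?F = "Fib C \<E>" and ?N = "{f. normal_extension C I H \<eta> \<E> f}"
  interpret A: category "arrow_cat C" by (rule C.arrow_cat_category)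
  interpret F: category ?F unfolding Fib_def by (rule A.full_subcat_category)
  have hom_F: "x \<in> hom ?F f m \<longleftrightarrow> (\<exists>u b. x = (f, (u, b), m) \<and> u \<in> hom C (Dom C f) (Dom C m) \<and>
      b \<in> hom C (Cod C f) (Cod C m) \<and> m \<cdot> u = b \<cdot> f)"
    if "f \<in> \<E>" "m \<in> \<E>" for x f m
    using that E_Mor by (cases x) (auto simp: Fib_def hom_def)
  have Comp_F: "(f', (a', b'), g') \<cdot>\<^bsub>?F\<^esub> (f, (a, b), g) = (f, (a' \<cdot> a, b' \<cdot> b), g')" for f' a' b' g' f a b g
    by (simp add: Fib_def)
  show ?thesis
    unfolding Norm_def
  proof (rule F.reflective_subcategory_if_universal_arrows)
    fix f assume "f \<in> Obj ?F"
    then have fE: "f \<in> \<E>" by (auto simp: Fib_def)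
    have B: "Cod C f \<in> Obj C" using C.hom_objs[OF E_hom[OF fE]] by simp
    show "\<exists>k \<in> Mor ?F. Dom ?F k = f \<and> Cod ?F k \<in> ?N \<and>
      (\<forall>m \<in> ?N. \<forall>t \<in> hom ?F f m. \<exists>!u. u \<in> hom ?F (Cod ?F k) m \<and> u \<cdot>\<^bsub>?F\<^esub> k = t)"
    proof (rule normal_reflection[OF fE])
      fix n k assume n: "normal_extension C I H \<eta> \<E> n" "Cod C n = Cod C f"
        and k: "k \<in> hom C (Dom C f) (Dom C n)" "n \<cdot> k = f"
        and univ: "\<And>m v \<beta>. \<lbrakk>normal_extension C I H \<eta> \<E> m; v \<in> hom C (Dom C f) (Dom C m);
            \<beta> \<in> hom C (Cod C f) (Cod C m); m \<cdot> v = \<beta> \<cdot> f\<rbrakk>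
          \<Longrightarrow> \<exists>!u. u \<in> hom C (Dom C n) (Dom C m) \<and> m \<cdot> u = \<beta> \<cdot> n \<and> u \<cdot> k = v"
      have nE: "n \<in> \<E>" using n by (simp add: normal_extension_def)
      let ?k = "(f, (k, Ident C (Cod C f)), n)"
      have K: "?k \<in> hom ?F f n"
        by (subst hom_F[OF fE nE]) (use k C.ident_hom[OF B] C.ident_left[OF E_hom[OF fE]] n(2) in auto)
      have cod: "Cod ?F ?k = n" using K by (simp add: F.in_hom_iff)
      show ?thesis
      proof (intro bexI[of _ ?k] conjI ballI, unfold cod)
        show "?k \<in> Mor ?F" "Dom ?F ?k = f" "n \<in> ?N"
          using K n by (simp_all add: F.in_hom_iff)
        fix m t assume m: "m \<in> ?N" and t: "t \<in> hom ?F f m"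
        have mE: "m \<in> \<E>" using m by (simp add: normal_extension_def)
        obtain v \<beta> where tv: "t = (f, (v, \<beta>), m)" and v: "v \<in> hom C (Dom C f) (Dom C m)"
          and \<beta>: "\<beta> \<in> hom C (Cod C f) (Cod C m)" and sq: "m \<cdot> v = \<beta> \<cdot> f"
          using t[unfolded hom_F[OF fE mE]] by blast
        have ex1: "\<exists>!u. u \<in> hom C (Dom C n) (Dom C m) \<and> m \<cdot> u = \<beta> \<cdot> n \<and> u \<cdot> k = v"
          using univ[OF _ v \<beta> sq] m by simp
        then obtain u where u: "u \<in> hom C (Dom C n) (Dom C m)" "m \<cdot> u = \<beta> \<cdot> n" "u \<cdot> k = v" by blast
        show "\<exists>!u. u \<in> hom ?F n m \<and> u \<cdot>\<^bsub>?F\<^esub> ?k = t"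
        proof (rule ex1I[of _ "(n, (u, \<beta>), m)"])
          show "(n, (u, \<beta>), m) \<in> hom ?F n m \<and> (n, (u, \<beta>), m) \<cdot>\<^bsub>?F\<^esub> ?k = t"
            unfolding hom_F[OF nE mE] Comp_F tv n(2) C.ident_right[OF \<beta>] using u \<beta> by blast
          fix x assume x: "x \<in> hom ?F n m \<and> x \<cdot>\<^bsub>?F\<^esub> ?k = t"
          then obtain w b where w: "x = (n, (w, b), m)" "w \<in> hom C (Dom C n) (Dom C m)"
            and b: "b \<in> hom C (Cod C f) (Cod C m)" "m \<cdot> w = b \<cdot> n"
            unfolding hom_F[OF nE mE] n(2) by blast
          have "w \<cdot> k = v" and b\<beta>: "b = \<beta>"
            using x by (simp_all add: w(1) Comp_F tv C.ident_right[OF b(1)])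
          then have "w = u" by - (rule ex1_unique[OF ex1]; intro conjI w u b(2)[unfolded b\<beta>]; assumption)
          then show "x = (n, (u, \<beta>), m)" by (simp only: w(1) b\<beta>)
        qed
      qed
    qed
  qed
qed

end

theorem theorem2p12:
  fixes C :: "('o, 'm) cat" and X :: "('p, 'n) cat"
    and I :: "('o, 'm, 'p, 'n) functr" and H :: "('p, 'n, 'o, 'm) functr"
    and \<eta> :: "'o \<Rightarrow> 'm" and \<epsilon> :: "'p \<Rightarrow> 'n"
    and \<E> :: "'m set" and \<F> :: "'n set"
  assumes galois: "galois_structure C X I H \<eta> \<epsilon> \<E> \<F>"
    and E_def: "\<E> = {e. regular_epi C e}"
    and F_def: "\<F> = {e. regular_epi X e}"
    and coequalisers: "has_reflexive_coequalisers C"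
    and admissible: "admissible C X I H \<eta> \<E> \<F>"
    and condition: "\<And>h p\<^sub>1 p\<^sub>2 \<delta> d c s f'' f' g f.
      \<lbrakk> regular_epi C h;
        is_kernel_pair C h p\<^sub>1 p\<^sub>2; reflexive_graph C p\<^sub>1 p\<^sub>2 \<delta>;
        reflexive_graph C d c s;
        f'' \<in> \<E>; f' \<in> \<E>;
        reflexive_graph (Fib C \<E>) (f'', (d, p\<^sub>1), f') (f'', (c, p\<^sub>2), f') (f', (s, \<delta>), f'');
        is_coequaliser C d c g;
        is_coequaliser (arrow_cat C) (f'', (d, p\<^sub>1), f') (f'', (c, p\<^sub>2), f') (f', (g, h), f);
        normal_extension C I H \<eta> \<E> f'; normal_extension C I H \<eta> \<E> f'' \<rbrakk>
      \<Longrightarrow> normal_extension C I H \<eta> \<E> f"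
  shows "(\<forall>B\<in>Obj C. reflective_subcategory (Norm_over C I H \<eta> \<E> B) (fib_over C \<E> B))
    \<and> reflective_subcategory (Norm C I H \<eta> \<E>) (Fib C \<E>)"
proof -
  interpret normal_descent C X I H \<eta> \<epsilon> \<E> \<F>
    by (intro normal_descent.intro admissible_galois_structure.intro admissible_galois_structure_axioms.intro
        normal_descent_axioms.intro galois admissible E_def coequalisers) (rule condition; assumption)
  show ?thesis
    using Norm_over_reflective Norm_reflective by blast
qed

end
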